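(* Let $d\ge1$ and let $\alpha=(\alpha_1,\dots,\alpha_d)\in\mathbb{R}^d$ be such that $1,\alpha_1,\dots,\alpha_d$ are linearly independent over $\mathbb{Q}$ and span a real algebraic number field of degree $d+1$ over $\mathbb{Q}$. Define $N_1=1$ and, for $i\ge2$, let $N_i$ be the smallest integer $N>N_{i-1}$ with $\langle N\alpha\rangle<\langle N_{i-1}\alpha\rangle$; let $z^{(i)}_j$ be the nearest integer to $N_i\alpha_j$, $j=1,\dots,d$. Then there is a constant $C$, independent of $i$, such that for all $i\ge 2$ \[ J(P_{N_i,z^{(i)}})\le \frac{C}{N_i^{1/d}}. \]
   Context: For $x\in\mathbb{R}^d$, $\langle x\rangle=\max_{1\le j\le d}\min_{k\in\mathbb{Z}}|x_j-k|$. For $N\in\mathbb{N}$ and $z\in\mathbb{Z}^d$ with $\gcd(N,z_1,\dots,z_d)=1$, the rank-1 lattice point set is $P_{N,z}=\{(\{nz_1/N\},\dots,\{nz_d/N\}) : n=0,\dots,N-1\}$, $\{x\}=x-\lfloor x\rfloor$. For an $N$-point set $P\subset[0,1)^d$, the isotropic discrepancy is $J(P)=\sup_{C\in\mathcal{C}}\left|\frac{|P\cap C|}{N}-\operatorname{vol}(C)\right|$, where $\mathcal{C}$ is the family of all convex subsets of $[0,1)^d$. *)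

theory Defs
  imports "HOL-Analysis.Analysis"
begin

definition dist_int :: "real \<Rightarrow> real" where
  "dist_int x = min (frac x) (1 - frac x)"

definition tnorm :: "real^'n::finite \<Rightarrow> real" where
  "tnorm x = Max ((\<lambda>j. dist_int (x $ j)) ` UNIV)"

text \<open>The sequence of best approximation denominators: best_den a i = N_i (i >= 1);
  index 0 is unused and set to 1.\<close>
fun best_den :: "real^'n::finite \<Rightarrow> nat \<Rightarrow> nat" where
  "best_den a 0 = 1"
| "best_den a (Suc 0) = 1"
| "best_den a (Suc (Suc i)) =
     (LEAST N. N > best_den a (Suc i) \<and>
        tnorm (of_nat N *\<^sub>R a) < tnorm (of_nat (best_den a (Suc i)) *\<^sub>R a))"

definition best_z :: "real^'n::finite \<Rightarrow> nat \<Rightarrow> 'n \<Rightarrow> int" where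
  "best_z a i j = round (real (best_den a i) * a $ j)"

definition lattice_pt :: "nat \<Rightarrow> ('n::finite \<Rightarrow> int) \<Rightarrow> nat \<Rightarrow> real^'n" where
  "lattice_pt N z n = (\<chi> j. frac (real n * real_of_int (z j) / real N))"

definition unit_cube :: "(real^'n::finite) set" where
  "unit_cube = {x. \<forall>j. 0 \<le> x $ j \<and> x $ j < 1}"

definition iso_disc :: "nat \<Rightarrow> (nat \<Rightarrow> real^'n::finite) \<Rightarrow> real" where
  "iso_disc N p = (SUP C \<in> {C. convex C \<and> C \<subseteq> unit_cube}.
      \<bar>real (card {n. n < N \<and> p n \<in> C}) / real N - measure lebesgue C\<bar>)"

definition rat_span :: "real^'n::finite \<Rightarrow> real set" where
  "rat_span a = {q0 + (\<Sum>j\<in>UNIV. q j * a $ j) | q0 q. q0 \<in> \<rat> \<and> (\<forall>j. q j \<in> \<rat>)}"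

end

(*
  Let d be the dimension. A nonzero integer vector h with |h_j| <= B and h.z = 0 mod N satisfies
  B >= c N^(1/d): with m = h.z / N, the form h.a - m is small because z is close to N a (Dirichlet
  bounds the error by 2 N^(-1/d)), and it is at least c B^(-d) because it is a nonzero element of a
  number field of degree d + 1. So the dual lattice has no vectors shorter than c N^(1/d). Averaging
  a localised nonnegative trigonometric polynomial of that bandwidth over a coset of the lattice,
  one sees that every cube of side C N^(-1/d) contains a lattice point. Hence the number of lattice
  points in a convex set is at most N times the volume of a slightly thickened set, and at least N
  times the volume of a slightly shrunken one.
*)
theory Submission
  imports Defs "HOL-Library.Real_Mod"
begin

section \<open>Best simultaneous approximations\<close>

text \<open>The obstacle is to turn arithmetic into geometry: the number field controls the dual
  lattice, while convex sets see the gaps between the points. Passing from "no short dual vector" to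
  "no large hole" is a transference step, done here by Parseval on an arbitrary coset, without
  lattice bases or successive minima; the loss is a constant depending on d only. Counts cannot be
  compared with volumes directly either, so shifts are averaged: over a unit cube of shifts the mean
  count in a body is exactly N times its volume, hence some shift does no worse, and the covering
  property supplies a lattice vector that nearly undoes this shift. The leftover displacement is
  what the thickened and shrunken sets absorb; placing it in [0, 2r]^d, a cube with a corner at 0,
  lets them be built one axis at a time. Being a best approximation is used twice: comparison with
  Dirichlet's denominator makes z close to N a, and the record property makes the N points distinct
  (equivalently gcd(N, z) = 1), which matters because \<open>iso_disc\<close> counts indices rather
  than points.\<close>

lemma dist_int_le: "dist_int x \<le> \<bar>x - of_int k\<bar>"
proof (cases "k \<le> \<lfloor>x\<rfloor>")
  case True
  then have "of_int k \<le> (of_int \<lfloor>x\<rfloor> :: real)" by simp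
  then show ?thesis unfolding dist_int_def frac_def by linarith
next
  case False
  then have "of_int (\<lfloor>x\<rfloor> + 1) \<le> (of_int k :: real)" by linarith
  then show ?thesis unfolding dist_int_def frac_def by (simp; linarith)
qed

lemma dist_int_eq_round: "dist_int x = \<bar>x - of_int (round x)\<bar>"
proof (rule antisym)
  show "\<bar>x - of_int (round x)\<bar> \<le> dist_int x"
    using round_diff_minimal[of x "\<lfloor>x\<rfloor>"] round_diff_minimal[of x "\<lfloor>x\<rfloor> + 1"]
    unfolding dist_int_def frac_def by (simp; linarith)
qed (rule dist_int_le)

lemma dist_int_le_tnorm: "dist_int (x $ j) \<le> tnorm x"
  unfolding tnorm_def by (rule Max_ge) auto

lemma tnorm_le_iff: "tnorm x \<le> b \<longleftrightarrow> (\<forall>j. dist_int (x $ j) \<le> b)"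
  unfolding tnorm_def by (subst Max_le_iff) auto

lemma tnorm_less_iff: "tnorm x < b \<longleftrightarrow> (\<forall>j. dist_int (x $ j) < b)"
  unfolding tnorm_def by (subst Max_less_iff) auto

lemma simultaneous_Dirichlet:
  fixes a :: "real^'n::finite"
  assumes "K > 0"
  obtains q where "0 < q" "q \<le> K ^ CARD('n)" "tnorm (real q *\<^sub>R a) < 1 / real K"
proof -
  obtain f where f: "bij_betw f {0..<CARD('n)} (UNIV :: 'n set)"
    using ex_bij_betw_nat_finite[of "UNIV :: 'n set"] by auto
  obtain q p where q: "0 < q" "q \<le> int (K ^ CARD('n))"
    and p: "\<And>i. i < CARD('n) \<Longrightarrow> \<bar>of_int q * a $ f i - of_int (p i)\<bar> < 1 / real K"
    using Dirichlet_approx_simult[OF assms, of "CARD('n)" "\<lambda>i. a $ f i"] by metis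
  have "dist_int (real (nat q) * a $ j) < 1 / real K" for j
  proof -
    obtain i where "i < CARD('n)" "j = f i"
      using f by (metis UNIV_I atLeastLessThan_iff bij_betw_def imageE)
    then show ?thesis
      using p[of i] dist_int_le[of "real (nat q) * a $ j" "p i"] q(1) by simp
  qed
  then have "tnorm (real (nat q) *\<^sub>R a) < 1 / real K"
    by (simp add: tnorm_less_iff)
  with q show thesis
    by (intro that[of "nat q"]) (auto simp: nat_le_iff)
qed

lemma tnorm_multiple_pos:
  fixes a :: "real^'n::finite"
  assumes irr: "\<And>j. a $ j \<notin> \<rat>" and "n > 0"
  shows "0 < tnorm (real n *\<^sub>R a)"
proof (rule ccontr)
  assume "\<not> ?thesis"
  then have "tnorm (real n *\<^sub>R a) \<le> 0" by simp
  then have "dist_int (real n * a $ j) \<le> 0" for j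
    by (simp add: tnorm_le_iff)
  then have "real n * a $ j = of_int (round (real n * a $ j))" for j
    by (metis abs_le_zero_iff dist_int_eq_round eq_iff_diff_eq_0)
  then have "a $ j = of_int (round (real n * a $ j)) / of_nat n" for j
    using \<open>n > 0\<close> by (metis nonzero_mult_div_cancel_left of_nat_0_less_iff less_numeral_extra(3))
  then have "a $ j \<in> \<rat>" for j
    by (metis Rats_divide Rats_of_int Rats_of_nat)
  with irr show False by blast
qed

lemma tnorm_multiple_arbitrarily_small:
  fixes a :: "real^'n::finite"
  assumes "e > 0"
  obtains q where "0 < q" "tnorm (real q *\<^sub>R a) < e"
proof -
  obtain K where K: "K > 0" "1 / real K < e"
    using assms by (metis nat_approx_posE zero_less_Suc)
  with simultaneous_Dirichlet[OF K(1), of a] that show thesis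
    by (metis order.strict_trans)
qed

text \<open>The recursion compares a new denominator only with its predecessor. The stronger record
  property follows by induction: a denominator up to the predecessor is no better than it by the
  induction hypothesis, one strictly in between by minimality of \<open>LEAST\<close>. Growth is
  stated from index 2 on because indices 0 and 1 both carry the value 1.\<close>

lemma best_den_record:
  fixes a :: "real^'n::finite"
  assumes irr: "\<And>j. a $ j \<notin> \<rat>"
  shows "best_den a i > 0 \<and>
    (\<forall>n. 0 < n \<and> n < best_den a i \<longrightarrow> tnorm (real (best_den a i) *\<^sub>R a) < tnorm (real n *\<^sub>R a)) \<and>
    (\<forall>k. i = Suc (Suc k) \<longrightarrow> best_den a (Suc k) < best_den a i)"
proof (induction i rule: induct_nat_012)
  case (ge2 i)
  define M where "M = best_den a (Suc i)"
  have M: "M > 0" "\<And>n. 0 < n \<Longrightarrow> n < M \<Longrightarrow> tnorm (real M *\<^sub>R a) < tnorm (real n *\<^sub>R a)"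
    using ge2 by (auto simp: M_def)
  define P where "P N \<longleftrightarrow> N > M \<and> tnorm (of_nat N *\<^sub>R a) < tnorm (of_nat M *\<^sub>R a)" for N
  obtain q where q: "0 < q" "tnorm (real q *\<^sub>R a) < tnorm (real M *\<^sub>R a)"
    using tnorm_multiple_arbitrarily_small[OF tnorm_multiple_pos[OF irr M(1)], of a] .
  \<comment> \<open>A denominator that beats the record \<open>M\<close> cannot be at most
    \<open>M\<close>, so \<open>q\<close> is an admissible candidate and the \<open>LEAST\<close> is
    not taken over an empty set.\<close>
  then have "P q"
    unfolding P_def by (metis M(2) linorder_neqE_nat order.asym)
  define N where "N = (LEAST N. P N)"
  have N: "P N" "\<And>n. n < N \<Longrightarrow> \<not> P n"
    unfolding N_def using \<open>P q\<close> by (auto intro: LeastI dest: not_less_Least)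
  have eq: "best_den a (Suc (Suc i)) = N"
    by (simp add: N_def P_def M_def)
  have "tnorm (real N *\<^sub>R a) < tnorm (real n *\<^sub>R a)" if n: "0 < n" "n < N" for n
  proof -
    have "tnorm (real M *\<^sub>R a) \<le> tnorm (real n *\<^sub>R a)"
      using M(2)[OF n(1)] N(2)[OF n(2)] unfolding P_def by (metis less_eq_real_def linorder_neqE_nat not_less)
    then show ?thesis using N(1) unfolding P_def by simp
  qed
  then show ?case
    unfolding eq using N(1) by (auto simp: P_def M_def)
qed auto

lemma best_den_ge_2:
  fixes a :: "real^'n::finite"
  assumes irr: "\<And>j. a $ j \<notin> \<rat>" and "i \<ge> 2"
  shows "best_den a i \<ge> 2"
proof -
  obtain k where "i = Suc (Suc k)"
    using \<open>i \<ge> 2\<close> by (metis add_2_eq_Suc le_Suc_ex)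
  then show ?thesis
    using best_den_record[OF irr, of i] best_den_record[OF irr, of "Suc k"] by fastforce
qed

lemma tnorm_best_den_le:
  fixes a :: "real^'n::finite"
  assumes irr: "\<And>j. a $ j \<notin> \<rat>" and "i \<ge> 2"
  shows "tnorm (real (best_den a i) *\<^sub>R a) \<le> 2 / real (best_den a i) powr (1 / real CARD('n))"
proof -
  define N where "N = best_den a i"
  define x where "x = real N powr (1 / real CARD('n))"
  have "N \<ge> 2" using best_den_ge_2[OF assms] by (simp add: N_def)
  have x1: "x > 1" unfolding x_def using \<open>N \<ge> 2\<close> by (intro gr_one_powr) auto
  have xd: "x ^ CARD('n) = real N"
    unfolding x_def using \<open>N \<ge> 2\<close> by (simp add: powr_power)
  \<comment> \<open>The largest integer strictly below \<open>x\<close>. Strictness puts Dirichlet's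
    \<open>q <= K ^ d\<close> below \<open>N\<close>, so the record \<open>N\<close> does better
    than \<open>q\<close>; and \<open>x <= K + 1 <= 2 * K\<close> is the origin of the 2 in the
    bound.\<close>
  define K where "K = nat (\<lceil>x\<rceil> - 1)"
  have K: "K \<ge> 1" "real K < x" "x \<le> real K + 1"
    using x1 unfolding K_def by linarith+
  obtain q where q: "0 < q" "q \<le> K ^ CARD('n)" "tnorm (real q *\<^sub>R a) < 1 / real K"
    using simultaneous_Dirichlet[of K a] K(1) by auto
  have "real K ^ CARD('n) < x ^ CARD('n)"
    using K by (intro power_strict_mono) auto
  then have "K ^ CARD('n) < N"
    unfolding xd by (metis of_nat_less_iff of_nat_power)
  with q have "tnorm (real N *\<^sub>R a) < 1 / real K"
    using best_den_record[OF irr, of i] unfolding N_def by (meson le_less_trans order.strict_trans)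
  also have "\<dots> \<le> 2 / x"
  proof -
    have "1 \<le> real K" using K(1) by simp
    then have "x \<le> 2 * real K" using K(3) by linarith
    then show ?thesis using \<open>1 \<le> real K\<close> x1 by (simp add: field_simps)
  qed
  finally show ?thesis unfolding x_def N_def by simp
qed

section \<open>Linear forms in a number field\<close>

lemma common_denominator:
  fixes f :: "'i \<Rightarrow> real"
  assumes "finite I" "\<And>i. i \<in> I \<Longrightarrow> f i \<in> \<rat>"
  shows "\<exists>D::nat. D > 0 \<and> (\<forall>i\<in>I. of_nat D * f i \<in> \<int>)"
  using assms
proof (induction rule: finite_induct)
  case (insert x I)
  then obtain D where D: "D > 0" "\<And>i. i \<in> I \<Longrightarrow> real D * f i \<in> \<int>" by auto
  obtain p n where "n > 0" and p: "f x = real_of_int p / real n"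
    using insert.prems[of x] unfolding Rats_eq_int_div_nat by auto
  have "real (D * n) * f i \<in> \<int>" if i: "i \<in> insert x I" for i
  proof (cases "i = x")
    case True
    have "real (D * n) * f x = of_int (int D * p)"
      using \<open>n > 0\<close> by (simp add: p)
    then show ?thesis using True by (metis Ints_of_int)
  next
    case False
    then have "real n * (real D * f i) \<in> \<int>"
      using i D(2)[of i] by (auto intro: Ints_mult[OF Ints_of_nat])
    then show ?thesis by (simp add: mult_ac)
  qed
  then show ?case using D(1) \<open>n > 0\<close> by (intro exI[of _ "D * n"]) auto
qed auto

text \<open>A norm argument without conjugates. The matrix \<open>mm q\<close> of multiplication by
  b = sum of q k w k has \<open>w\<close> as eigenvector with eigenvalue b. Once the denominators of
  the structure constants \<open>T\<close> are cleared, its determinant is a nonzero integer, hence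
  at least 1 in absolute value; on the other hand it can be computed with one column of size O(|b|)
  and the others of size O(B).\<close>

lemma integer_combination_lower_bound:
  fixes w :: "real^'k::finite" and T :: "'k \<Rightarrow> 'k \<Rightarrow> 'k \<Rightarrow> real"
  assumes w0: "w $ k0 = 1"
    and T: "\<And>i j k. T i j k \<in> \<rat>" "\<And>i j. w $ i * w $ j = (\<Sum>k\<in>UNIV. T i j k * w $ k)"
    and indep: "\<And>q. (\<And>k. q k \<in> \<rat>) \<Longrightarrow> (\<Sum>k\<in>UNIV. q k * w $ k) = 0 \<Longrightarrow> (\<forall>k. q k = 0)"
    and inv: "\<And>q. (\<And>k. q k \<in> \<rat>) \<Longrightarrow> (\<Sum>k\<in>UNIV. q k * w $ k) \<noteq> 0 \<Longrightarrow>
       \<exists>r. (\<forall>k. r k \<in> \<rat>) \<and> (\<Sum>k\<in>UNIV. q k * w $ k) * (\<Sum>k\<in>UNIV. r k * w $ k) = 1"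
  shows "\<exists>c>0. \<forall>(H::'k \<Rightarrow> int) B. (\<exists>k. H k \<noteq> 0) \<longrightarrow> (\<forall>k. \<bar>real_of_int (H k)\<bar> \<le> B) \<longrightarrow>
     c \<le> \<bar>\<Sum>k\<in>UNIV. of_int (H k) * w $ k\<bar> * B ^ (CARD('k) - 1)"
proof -
  define mm where "mm q = (\<chi> j k. \<Sum>i\<in>UNIV. q i * T i j k)" for q :: "'k \<Rightarrow> real"
  have mm_w: "mm q *v w = (\<Sum>k\<in>UNIV. q k * w $ k) *\<^sub>R w" for q
  proof -
    have "(\<Sum>k\<in>UNIV. (\<Sum>i\<in>UNIV. q i * T i j k) * w $ k) = (\<Sum>i\<in>UNIV. q i * w $ i) * w $ j" for j
    proof -
      have "(\<Sum>k\<in>UNIV. (\<Sum>i\<in>UNIV. q i * T i j k) * w $ k) = (\<Sum>i\<in>UNIV. q i * (\<Sum>k\<in>UNIV. T i j k * w $ k))"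
        by (simp add: sum_distrib_left sum_distrib_right mult.assoc) (rule sum.swap)
      also have "\<dots> = (\<Sum>i\<in>UNIV. q i * w $ i) * w $ j"
        by (simp add: T(2)[symmetric] sum_distrib_right mult.assoc)
      finally show ?thesis .
    qed
    then show ?thesis
      by (simp add: mm_def matrix_vector_mult_def vec_eq_iff)
  qed
  have mm_rat: "mm q $ j $ k \<in> \<rat>" if "\<And>k. q k \<in> \<rat>" for q j k
    unfolding mm_def by (simp add: T(1) that Rats_sum)
  \<comment> \<open>With \<open>r\<close> the coefficients of the inverse,
    \<open>mm r ** mm q\<close> fixes \<open>w\<close>. Each row of its difference from the identity
    is then a rational relation among the \<open>w $ k\<close>, so it vanishes by independence. This
    bypasses proving that \<open>mm\<close> is multiplicative.\<close>
  have det_nz: "det (mm q) \<noteq> 0" if q: "\<And>k. q k \<in> \<rat>" and nz: "(\<Sum>k\<in>UNIV. q k * w $ k) \<noteq> 0" for q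
  proof -
    obtain r where r: "\<And>k. r k \<in> \<rat>" "(\<Sum>k\<in>UNIV. q k * w $ k) * (\<Sum>k\<in>UNIV. r k * w $ k) = 1"
      using inv[OF q nz] by blast
    define A where "A = mm r ** mm q - mat 1"
    have "A *v w = 0"
      using r(2) by (simp add: A_def matrix_vector_mult_diff_rdistrib matrix_vector_mul_assoc[symmetric]
          mm_w matrix_vector_mult_scaleR)
    then have row: "(\<Sum>k\<in>UNIV. A $ j $ k * w $ k) = 0" for j
      by (simp add: matrix_vector_mult_def vec_eq_iff)
    have "A $ j $ k \<in> \<rat>" for j k
      unfolding A_def by (auto simp: matrix_matrix_mult_def mat_def intro!: Rats_diff Rats_mult mm_rat q r)
    then have "A $ j $ k = 0" for j k
      using indep[of "\<lambda>k. A $ j $ k"] row by blast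
    then have "mm r ** mm q = mat 1"
      by (simp add: A_def vec_eq_iff)
    then have "det (mm r) * det (mm q) = 1"
      by (metis det_I det_mul)
    then show ?thesis by auto
  qed
  obtain D :: nat where D: "D > 0" "\<And>i j k. of_nat D * T i j k \<in> \<int>"
    using common_denominator[of "UNIV :: ('k \<times> 'k \<times> 'k) set" "\<lambda>(i, j, k). T i j k"] T(1) by auto
  define S where "S = (\<Sum>i\<in>UNIV. \<Sum>j\<in>UNIV. \<Sum>k\<in>UNIV. \<bar>of_nat D * T i j k\<bar>)"
  define W where "W = (\<Sum>i\<in>UNIV. \<bar>w $ i\<bar>)"
  have W: "\<bar>w $ i\<bar> \<le> W" for i
    unfolding W_def by (rule member_le_sum) auto
  have "W \<ge> 1" using W[of k0] w0 by simp
  \<comment> \<open>One determinant term has a single factor \<open>D * |b| * W\<close> from column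
    \<open>k0\<close> and CARD - 1 factors up to \<open>(S + 1) * B\<close>; the factorial counts
    the permutations. Using \<open>S + 1\<close> in place of \<open>S\<close> makes
    \<open>F > 0\<close> immediate.\<close>
  define F where "F = fact CARD('k) * (real D * W) * (S + 1) ^ (CARD('k) - 1)"
  have "S \<ge> 0" unfolding S_def by (intro sum_nonneg) auto
  have "F > 0" unfolding F_def using \<open>W \<ge> 1\<close> \<open>S \<ge> 0\<close> D(1) by (intro mult_pos_pos zero_less_power) auto
  have "1 \<le> F * (\<bar>\<Sum>k\<in>UNIV. of_int (H k) * w $ k\<bar> * B ^ (CARD('k) - 1))"
    if H: "H k1 \<noteq> 0" "\<And>k. \<bar>real_of_int (H k)\<bar> \<le> B" for H :: "'k \<Rightarrow> int" and B k1
  proof -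
    define b where "b = (\<Sum>k\<in>UNIV. of_int (H k) * w $ k)"
    define q :: "'k \<Rightarrow> real" where "q k = of_int (H k)" for k
    define A where "A = mm (\<lambda>k. real D * q k)"
    have "B \<ge> 0" using H(2)[of k1] by linarith
    have Aw: "A *v w = (D * b) *\<^sub>R w"
      unfolding A_def mm_w b_def q_def by (simp add: sum_distrib_left mult.assoc)
    have "b \<noteq> 0"
      using indep[of "\<lambda>k. of_int (H k)"] H(1) by (auto simp: b_def)
    then have "det A \<noteq> 0"
      unfolding A_def using D(1) by (intro det_nz) (auto simp: q_def b_def sum_distrib_left[symmetric] mult.assoc)
    have A_eq: "A $ j $ k = (\<Sum>i\<in>UNIV. of_int (H i) * (real D * T i j k))" for j k
      by (simp add: A_def mm_def q_def mult_ac)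
    then have "A $ j $ k \<in> \<int>" for j k
      by (auto intro!: Ints_sum Ints_mult D(2))
    then have "det A \<in> \<int>"
      unfolding det_def by (intro Ints_sum Ints_mult Ints_prod) auto
    with \<open>det A \<noteq> 0\<close> have "1 \<le> \<bar>det A\<bar>"
      by (rule Ints_nonzero_abs_ge1[rotated])
    have A_le: "\<bar>A $ j $ k\<bar> \<le> (S + 1) * B" for j k
    proof -
      have "\<bar>A $ j $ k\<bar> \<le> (\<Sum>i\<in>UNIV. B * \<bar>real D * T i j k\<bar>)"
        unfolding A_eq by (rule order_trans[OF sum_abs sum_mono]) (auto simp: abs_mult intro!: mult_right_mono H(2))
      also have "\<dots> = B * (\<Sum>i\<in>UNIV. \<bar>real D * T i j k\<bar>)" by (simp add: sum_distrib_left)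
      finally have "\<bar>A $ j $ k\<bar> \<le> B * (\<Sum>i\<in>UNIV. \<bar>real D * T i j k\<bar>)" .
      moreover have "(\<Sum>i\<in>UNIV. \<bar>real D * T i j k\<bar>) \<le> S"
        unfolding S_def
      proof (rule sum_mono)
        fix i
        have "\<bar>real D * T i j k\<bar> \<le> (\<Sum>k\<in>UNIV. \<bar>real D * T i j k\<bar>)"
          by (rule member_le_sum) auto
        also have "\<dots> \<le> (\<Sum>j\<in>UNIV. \<Sum>k\<in>UNIV. \<bar>real D * T i j k\<bar>)"
          by (rule member_le_sum[of j UNIV "\<lambda>j. \<Sum>k\<in>UNIV. \<bar>real D * T i j k\<bar>"]) (auto intro: sum_nonneg)
        finally show "\<bar>real D * T i j k\<bar> \<le> \<dots>" .
      qed
      ultimately have "\<bar>A $ j $ k\<bar> \<le> B * S"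
        using \<open>B \<ge> 0\<close> mult_left_mono order_trans by blast
      then show ?thesis using \<open>B \<ge> 0\<close> by (simp add: algebra_simps)
    qed
    define E where "E = (\<chi> i j. if j = k0 then (A *v w) $ i else A $ i $ j)"
    \<comment> \<open>Since \<open>w $ k0 = 1\<close>, replacing column \<open>k0\<close> by \<open>A *v w\<close>, which is small, is a column operation.\<close>
    have "det E = det A"
      using cramer_lemma[where A = A and x = w and k = k0] w0 by (simp add: E_def)
    define f where "f j = (if j = k0 then real D * \<bar>b\<bar> * W else (S + 1) * B)" for j
    have E_le: "\<bar>E $ i $ j\<bar> \<le> f j" for i j
      using A_le W[of i] by (auto simp: E_def f_def Aw abs_mult intro!: mult_left_mono)
    have "\<bar>det E\<bar> \<le> (\<Sum>p\<in>{p. p permutes (UNIV::'k set)}. prod f UNIV)"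
      unfolding det_def
    proof (rule order_trans[OF sum_abs sum_mono])
      fix p :: "'k \<Rightarrow> 'k" assume p: "p \<in> {p. p permutes UNIV}"
      have "\<bar>of_int (sign p) * (\<Prod>i\<in>UNIV. E $ i $ p i)\<bar> = (\<Prod>i\<in>UNIV. \<bar>E $ i $ p i\<bar>)"
        by (simp add: abs_mult abs_prod sign_def)
      also have "\<dots> \<le> (\<Prod>i\<in>UNIV. f (p i))"
        by (intro prod_mono) (auto intro: E_le)
      also have "\<dots> = prod f UNIV"
        using prod.permute[of p UNIV f] p by (simp add: comp_def)
      finally show "\<bar>of_int (sign p) * (\<Prod>i\<in>UNIV. E $ i $ p i)\<bar> \<le> prod f UNIV" .
    qed
    also have "\<dots> = fact CARD('k) * prod f UNIV"
      by (simp add: card_permutations)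
    also have "prod f UNIV = f k0 * prod f (UNIV - {k0})"
      by (rule prod.remove) auto
    also have "prod f (UNIV - {k0}) = (\<Prod>j\<in>UNIV - {k0}. (S + 1) * B)"
      by (intro prod.cong) (auto simp: f_def)
    also have "\<dots> = ((S + 1) * B) ^ (CARD('k) - 1)"
      by (simp add: card_Diff_singleton)
    finally show ?thesis
      using \<open>1 \<le> \<bar>det A\<bar>\<close> \<open>det E = det A\<close>
      by (simp add: f_def F_def b_def power_mult_distrib mult_ac)
  qed
  then have "\<forall>(H::'k \<Rightarrow> int) B. (\<exists>k. H k \<noteq> 0) \<longrightarrow> (\<forall>k. \<bar>real_of_int (H k)\<bar> \<le> B) \<longrightarrow>
     1 / F \<le> \<bar>\<Sum>k\<in>UNIV. of_int (H k) * w $ k\<bar> * B ^ (CARD('k) - 1)"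
    using \<open>F > 0\<close> by (fastforce simp: divide_le_eq mult.commute)
  then show ?thesis using \<open>F > 0\<close> by (intro exI[of _ "1 / F"]) auto
qed

lemma sum_option_UNIV:
  fixes f :: "'a::finite option \<Rightarrow> 'b::comm_monoid_add"
  shows "(\<Sum>k\<in>UNIV. f k) = f None + (\<Sum>j\<in>UNIV. f (Some j))"
  by (simp add: UNIV_option_conv sum.reindex)

text \<open>The basis 1, a_1, ..., a_d is indexed by \<open>'n option\<close> with
  \<open>None\<close> for the constant 1, so that the exponent CARD - 1 of the previous lemma
  becomes d. Closure of the span under products yields the structure constants.\<close>

lemma linear_form_lower_bound:
  fixes a :: "real^'n::finite"
  assumes lin_indep: "\<And>q0 q. q0 \<in> \<rat> \<Longrightarrow> (\<forall>j. q j \<in> \<rat>) \<Longrightarrow>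
             q0 + (\<Sum>j\<in>UNIV. q j * a $ j) = 0 \<Longrightarrow> q0 = 0 \<and> (\<forall>j. q j = 0)"
    and field: "\<forall>x\<in>rat_span a. \<forall>y\<in>rat_span a. x * y \<in> rat_span a \<and> (x \<noteq> 0 \<longrightarrow> inverse x \<in> rat_span a)"
  shows "\<exists>c>0. \<forall>(h0::int) (h::'n \<Rightarrow> int) B. (\<exists>j. h j \<noteq> 0) \<longrightarrow> \<bar>real_of_int h0\<bar> \<le> B \<longrightarrow>
     (\<forall>j. \<bar>real_of_int (h j)\<bar> \<le> B) \<longrightarrow>
     c \<le> \<bar>of_int h0 + (\<Sum>j\<in>UNIV. of_int (h j) * a $ j)\<bar> * B ^ CARD('n)"
proof -
  define w :: "real^('n option)" where "w = (\<chi> k. case k of None \<Rightarrow> 1 | Some j \<Rightarrow> a $ j)"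
  have span_iff: "x \<in> rat_span a \<longleftrightarrow> (\<exists>q. (\<forall>k. q k \<in> \<rat>) \<and> x = (\<Sum>k\<in>UNIV. q k * w $ k))" for x
  proof
    assume "x \<in> rat_span a"
    then obtain q0 q where "q0 \<in> \<rat>" "\<forall>j. q j \<in> \<rat>" "x = q0 + (\<Sum>j\<in>UNIV. q j * a $ j)"
      unfolding rat_span_def by auto
    then show "\<exists>q. (\<forall>k. q k \<in> \<rat>) \<and> x = (\<Sum>k\<in>UNIV. q k * w $ k)"
      by (intro exI[of _ "\<lambda>k. case k of None \<Rightarrow> q0 | Some j \<Rightarrow> q j"])
         (auto simp: sum_option_UNIV w_def split: option.split)
  next
    assume "\<exists>q. (\<forall>k. q k \<in> \<rat>) \<and> x = (\<Sum>k\<in>UNIV. q k * w $ k)"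
    then obtain q where "\<forall>k. q k \<in> \<rat>" "x = (\<Sum>k\<in>UNIV. q k * w $ k)" by blast
    then show "x \<in> rat_span a"
      unfolding rat_span_def
      by (auto simp: sum_option_UNIV w_def intro!: exI[of _ "q None"] exI[of _ "\<lambda>j. q (Some j)"])
  qed
  have w_span: "w $ i \<in> rat_span a" for i
    unfolding span_iff by (intro exI[of _ "\<lambda>k. if k = i then 1 else 0"])
      (auto simp: if_distrib[of "\<lambda>x. x * _"] cong: if_cong)
  then have "\<exists>q. (\<forall>k. q k \<in> \<rat>) \<and> w $ i * w $ j = (\<Sum>k\<in>UNIV. q k * w $ k)" for i j
    using field span_iff by blast
  then obtain T where T: "\<And>i j k. T i j k \<in> \<rat>" "\<And>i j. w $ i * w $ j = (\<Sum>k\<in>UNIV. T i j k * w $ k)"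
    by metis
  have "\<exists>c>0. \<forall>(H::'n option \<Rightarrow> int) B. (\<exists>k. H k \<noteq> 0) \<longrightarrow> (\<forall>k. \<bar>real_of_int (H k)\<bar> \<le> B) \<longrightarrow>
     c \<le> \<bar>\<Sum>k\<in>UNIV. of_int (H k) * w $ k\<bar> * B ^ (CARD('n option) - 1)"
  proof (rule integer_combination_lower_bound)
    show "w $ None = 1" by (simp add: w_def)
    show "\<forall>k. q k = 0" if "\<And>k. q k \<in> \<rat>" "(\<Sum>k\<in>UNIV. q k * w $ k) = 0" for q
    proof -
      have "q None = 0 \<and> (\<forall>j. q (Some j) = 0)"
        using that by (intro lin_indep) (auto simp: sum_option_UNIV w_def)
      then show ?thesis by (metis not_None_eq)
    qed
    show "\<exists>r. (\<forall>k. r k \<in> \<rat>) \<and> (\<Sum>k\<in>UNIV. q k * w $ k) * (\<Sum>k\<in>UNIV. r k * w $ k) = 1"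
      if "\<And>k. q k \<in> \<rat>" "(\<Sum>k\<in>UNIV. q k * w $ k) \<noteq> 0" for q
    proof -
      have "inverse (\<Sum>k\<in>UNIV. q k * w $ k) \<in> rat_span a"
        using field that span_iff by blast
      then show ?thesis unfolding span_iff using that(2) by (metis right_inverse)
    qed
  qed (use T in auto)
  then obtain c where c: "c > 0" "\<And>(H::'n option \<Rightarrow> int) B. (\<exists>k. H k \<noteq> 0) \<Longrightarrow> (\<forall>k. \<bar>real_of_int (H k)\<bar> \<le> B) \<Longrightarrow>
     c \<le> \<bar>\<Sum>k\<in>UNIV. of_int (H k) * w $ k\<bar> * B ^ (CARD('n option) - 1)"
    by blast
  show ?thesis
  proof (intro exI[of _ c] conjI allI impI c(1))
    fix h0 :: int and h :: "'n \<Rightarrow> int" and B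
    assume h: "\<exists>j. h j \<noteq> 0" "\<bar>real_of_int h0\<bar> \<le> B" "\<forall>j. \<bar>real_of_int (h j)\<bar> \<le> B"
    then have "\<exists>k. case_option h0 h k \<noteq> 0" by (metis option.simps(5))
    with h show "c \<le> \<bar>of_int h0 + (\<Sum>j\<in>UNIV. of_int (h j) * a $ j)\<bar> * B ^ CARD('n)"
      using c(2)[of "case_option h0 h" B]
      by (auto simp: sum_option_UNIV w_def split: option.split)
  qed
qed

lemma coord_irrational:
  fixes a :: "real^'n::finite"
  assumes lin_indep: "\<And>q0 q. q0 \<in> \<rat> \<Longrightarrow> (\<forall>j. q j \<in> \<rat>) \<Longrightarrow>
             q0 + (\<Sum>j\<in>UNIV. q j * a $ j) = 0 \<Longrightarrow> q0 = 0 \<and> (\<forall>j. q j = 0)"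
  shows "a $ j \<notin> \<rat>"
proof
  assume "a $ j \<in> \<rat>"
  then have "\<forall>i. (if i = j then 1 else 0 :: real) = 0"
    using lin_indep[of "- a $ j" "\<lambda>i. if i = j then 1 else 0"]
    by (auto simp: if_distrib[of "\<lambda>x. x * _"] cong: if_cong)
  then show False by (metis zero_neq_one)
qed

text \<open>Put x = N^(1/d) and b = h.a - m. Up to constants, |b| <= B / (N x) from above and |b| >=
  B^(-d) from below, that is x^(d+1) <= B^(d+1). The exponents match because the Dirichlet exponent
  1/d and the field degree d + 1 fit together, so no power of N is lost.\<close>

lemma dual_vector_lower_bound:
  fixes a :: "real^'n::finite"
  assumes lin_indep: "\<And>q0 q. q0 \<in> \<rat> \<Longrightarrow> (\<forall>j. q j \<in> \<rat>) \<Longrightarrow>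
             q0 + (\<Sum>j\<in>UNIV. q j * a $ j) = 0 \<Longrightarrow> q0 = 0 \<and> (\<forall>j. q j = 0)"
    and field: "\<forall>x\<in>rat_span a. \<forall>y\<in>rat_span a. x * y \<in> rat_span a \<and> (x \<noteq> 0 \<longrightarrow> inverse x \<in> rat_span a)"
  shows "\<exists>c>0. \<forall>i\<ge>2. \<forall>(h::'n \<Rightarrow> int) B. (\<exists>j. h j \<noteq> 0) \<longrightarrow> (\<forall>j. \<bar>real_of_int (h j)\<bar> \<le> B) \<longrightarrow>
     int (best_den a i) dvd (\<Sum>j\<in>UNIV. h j * best_z a i j) \<longrightarrow>
     c * real (best_den a i) powr (1 / real CARD('n)) \<le> B"
proof -
  define d where "d = CARD('n)"
  have d: "d \<ge> 1" unfolding d_def by (simp add: Suc_le_eq)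
  have irr: "a $ j \<notin> \<rat>" for j using coord_irrational[OF lin_indep] by blast
  obtain c where c: "c > 0" and lower: "\<And>(h0::int) (h::'n \<Rightarrow> int) B. (\<exists>j. h j \<noteq> 0) \<Longrightarrow> \<bar>real_of_int h0\<bar> \<le> B \<Longrightarrow>
     (\<forall>j. \<bar>real_of_int (h j)\<bar> \<le> B) \<Longrightarrow>
     c \<le> \<bar>of_int h0 + (\<Sum>j\<in>UNIV. of_int (h j) * a $ j)\<bar> * B ^ d"
    using linear_form_lower_bound[OF lin_indep field] unfolding d_def by blast
  \<comment> \<open>Chosen so that \<open>A * B\<close> bounds all coefficients of the form
    \<open>b\<close>, including \<open>m\<close>: the crude estimate \<open>|b| <= 2 * d * B\<close>
    and \<open>|h.a| <= B * (\<Sum>j. |a j|)\<close> add up to \<open>A * B\<close>.\<close>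
  define A where "A = (\<Sum>j\<in>UNIV. \<bar>a $ j\<bar>) + 2 * real d"
  have "0 \<le> (\<Sum>j\<in>UNIV. \<bar>a $ j\<bar>)" by (intro sum_nonneg) auto
  then have "A \<ge> 1" using d unfolding A_def by linarith
  \<comment> \<open>Avoids a (d+1)-st root: as \<open>g <= 1\<close>, the power
    \<open>g ^ (d + 1)\<close> is at most \<open>g\<close>, and \<open>g\<close> is already small
    enough to absorb \<open>2 * d * A ^ d / c\<close>.\<close>
  define g where "g = min 1 (c / (2 * real d * A ^ d))"
  have g: "g > 0" "g \<le> 1" "g * (2 * real d * A ^ d) \<le> c"
    using c \<open>A \<ge> 1\<close> d by (auto simp: g_def min_def field_simps)
  have "g * real (best_den a i) powr (1 / real d) \<le> B"
    if i: "i \<ge> 2" and h: "h j0 \<noteq> 0" "\<And>j. \<bar>real_of_int (h j)\<bar> \<le> B"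
      and dvd: "int (best_den a i) dvd (\<Sum>j\<in>UNIV. h j * best_z a i j)" for i and h :: "'n \<Rightarrow> int" and j0 B
  proof (rule ccontr)
    define N where "N = best_den a i"
    define x where "x = real N powr (1 / real d)"
    assume "\<not> ?thesis"
    then have "B < g * x" by (simp add: x_def N_def)
    have "N \<ge> 2" using best_den_ge_2[OF irr i] by (simp add: N_def)
    have x1: "x > 1" unfolding x_def using \<open>N \<ge> 2\<close> d by (intro gr_one_powr) auto
    have xd: "x ^ d = real N"
      unfolding x_def using \<open>N \<ge> 2\<close> d by (simp add: powr_power)
    have "\<bar>real_of_int (h j0)\<bar> \<ge> 1" using h(1) by linarith
    then have "B \<ge> 1" using h(2)[of j0] by linarith
    define e where "e j = real N * a $ j - best_z a i j" for j
    have e: "\<bar>e j\<bar> \<le> 2 / x" for j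
    proof -
      have "\<bar>e j\<bar> = dist_int ((real N *\<^sub>R a) $ j)"
        by (simp add: e_def best_z_def N_def dist_int_eq_round)
      also have "\<dots> \<le> 2 / x"
        using tnorm_best_den_le[OF irr i] dist_int_le_tnorm order_trans unfolding x_def N_def d_def by blast
      finally show ?thesis .
    qed
    obtain m where m: "(\<Sum>j\<in>UNIV. h j * best_z a i j) = int N * m"
      using dvd unfolding N_def by auto
    define b where "b = of_int (- m) + (\<Sum>j\<in>UNIV. of_int (h j) * a $ j)"
    have "real N * b = (\<Sum>j\<in>UNIV. of_int (h j) * (real N * a $ j)) - of_int (int N * m)"
      by (simp add: b_def algebra_simps sum_distrib_left)
    also have "\<dots> = (\<Sum>j\<in>UNIV. of_int (h j) * e j)"
      unfolding m[symmetric] by (simp add: e_def algebra_simps sum_subtractf)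
    finally have "real N * \<bar>b\<bar> = \<bar>\<Sum>j\<in>UNIV. of_int (h j) * e j\<bar>"
      by (metis abs_mult abs_of_nat)
    also have "\<dots> \<le> (\<Sum>j\<in>(UNIV::'n set). B * (2 / x))"
    proof (rule order_trans[OF sum_abs sum_mono])
      fix j
      show "\<bar>of_int (h j) * e j\<bar> \<le> B * (2 / x)"
        unfolding abs_mult using h(2) e \<open>B \<ge> 1\<close> by (intro mult_mono) auto
    qed
    finally have Nb: "real N * \<bar>b\<bar> \<le> real d * B * (2 / x)" by (simp add: d_def)
    also have "\<dots> \<le> real d * B * 2"
      using x1 \<open>B \<ge> 1\<close> by (intro mult_left_mono) (auto simp: field_simps)
    finally have "\<bar>b\<bar> \<le> 2 * real d * B"
      using \<open>N \<ge> 2\<close> mult_right_mono[of 1 "real N" "\<bar>b\<bar>"] by simp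
    moreover have "\<bar>\<Sum>j\<in>UNIV. of_int (h j) * a $ j\<bar> \<le> (\<Sum>j\<in>UNIV. B * \<bar>a $ j\<bar>)"
      using h(2) by (intro order_trans[OF sum_abs sum_mono]) (auto simp: abs_mult intro!: mult_right_mono)
    ultimately have "\<bar>real_of_int (- m)\<bar> \<le> A * B"
      unfolding A_def b_def by (simp add: sum_distrib_left[symmetric] algebra_simps; linarith)
    moreover have "\<bar>real_of_int (h j)\<bar> \<le> A * B" for j
      using h(2)[of j] \<open>A \<ge> 1\<close> \<open>B \<ge> 1\<close> mult_right_mono[of 1 A B] by linarith
    ultimately have "c \<le> \<bar>b\<bar> * (A * B) ^ d"
      unfolding b_def using h(1) by (intro lower) auto
    then have "c * real N \<le> (real N * \<bar>b\<bar>) * (A * B) ^ d"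
      using mult_left_mono[of c "\<bar>b\<bar> * (A * B) ^ d" "real N"] by (simp add: mult_ac)
    also have "\<dots> \<le> (real d * B * (2 / x)) * (A * B) ^ d"
      using Nb \<open>A \<ge> 1\<close> \<open>B \<ge> 1\<close> by (intro mult_right_mono) auto
    finally have "c * x ^ d * x \<le> 2 * real d * A ^ d * B ^ Suc d"
      using x1 xd by (simp add: field_simps power_mult_distrib)
    also have "\<dots> < 2 * real d * A ^ d * (g * x) ^ Suc d"
      using \<open>B < g * x\<close> \<open>B \<ge> 1\<close> \<open>A \<ge> 1\<close> d by (intro mult_strict_left_mono power_strict_mono) auto
    also have "\<dots> = 2 * real d * A ^ d * (g * g ^ d) * x ^ Suc d"
      by (simp add: power_mult_distrib)
    also have "\<dots> \<le> 2 * real d * A ^ d * (g * 1) * x ^ Suc d"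
      using g \<open>A \<ge> 1\<close> x1 d by (intro mult_right_mono mult_left_mono power_le_one) auto
    also have "\<dots> \<le> c * x ^ Suc d"
      using g(3) x1 by (intro mult_right_mono) (auto simp: mult_ac)
    finally show False by (simp add: mult_ac)
  qed
  with g(1) show ?thesis unfolding d_def by blast
qed

section \<open>Covering by a lattice without short dual vectors\<close>

definition char1 :: "real \<Rightarrow> complex" where "char1 t = cis (2 * pi * t)"

lemma char1_add: "char1 (s + t) = char1 s * char1 t"
  by (simp add: char1_def cis_mult distrib_left)

lemma char1_minus: "char1 (- t) = cnj (char1 t)"
  by (simp add: char1_def cis_cnj)

lemma char1_int [simp]: "char1 (of_int k) = 1"
  unfolding char1_def by (metis cis_multiple_2pi Ints_of_int)

lemma char1_sum: "finite I \<Longrightarrow> char1 (\<Sum>i\<in>I. f i) = (\<Prod>i\<in>I. char1 (f i))"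
  by (induction I rule: finite_induct) (auto simp: char1_add, simp add: char1_def)

lemma sum_char1_eq_0:
  assumes "N > 0" "\<not> int N dvd w"
  shows "(\<Sum>n<N. char1 (real n * real_of_int w / real N)) = 0"
proof -
  define z where "z = char1 (real_of_int w / real N)"
  have pow: "char1 (real n * real_of_int w / real N) = z ^ n" for n
  proof -
    have "2 * pi * (real n * real_of_int w / real N) = real n * (2 * pi * (real_of_int w / real N))"
      by simp
    then show ?thesis unfolding z_def char1_def Complex.DeMoivre by (rule arg_cong[of _ _ cis])
  qed
  have "z \<noteq> 1"
  proof
    assume "z = 1"
    then obtain k :: int where "2 * pi * (real_of_int w / real N) = of_int k * (2 * pi)"
      unfolding z_def char1_def cis_eq_1_iff by auto
    then have "real_of_int w = of_int (k * int N)"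
      using assms(1) by (simp add: field_simps)
    then have "w = k * int N" by (simp only: of_int_eq_iff)
    then show False using assms(2) by simp
  qed
  have "z ^ N = 1"
    using pow[of N] assms(1) by simp
  have "(\<Sum>n<N. z ^ n) = 0"
    using \<open>z \<noteq> 1\<close> \<open>z ^ N = 1\<close> by (simp add: sum_gp_strict)
  then show ?thesis by (simp add: pow)
qed

text \<open>By the hypothesis on \<open>z\<close>, distinct frequencies in the box \<open>{-m..m}\<^sup>d\<close> restrict to distinct characters
  of the group generated by \<open>z / N\<close>, and these are orthogonal on each coset.\<close>

lemma lattice_Parseval:
  fixes y :: "'n::finite \<Rightarrow> real" and z :: "'n \<Rightarrow> int" and g :: "'n \<Rightarrow> int \<Rightarrow> real"
  assumes "N > 0"
    and dual: "\<And>h. (\<exists>j. h j \<noteq> 0) \<Longrightarrow> (\<forall>j. \<bar>h j\<bar> \<le> 2 * m) \<Longrightarrow> \<not> int N dvd (\<Sum>j\<in>UNIV. h j * z j)"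
  shows "(\<Sum>n<N. \<Prod>j\<in>UNIV. (cmod (\<Sum>l\<in>{-m..m}. of_real (g j l) *
            char1 (of_int l * (y j + real n * of_int (z j) / real N))))\<^sup>2) =
         real N * (\<Prod>j\<in>UNIV. \<Sum>l\<in>{-m..m}. (g j l)\<^sup>2)"
proof -
  define L where "L = (PiE UNIV (\<lambda>_. {-m..m}) :: ('n \<Rightarrow> int) set)"
  have "finite L" unfolding L_def by (intro finite_PiE) auto
  define x where "x n j = y j + real n * of_int (z j) / real N" for n j
  define c where "c l = (\<Prod>j\<in>UNIV. g j (l j))" for l :: "'n \<Rightarrow> int"
  define e where "e l n = char1 (\<Sum>j\<in>UNIV. of_int (l j) * x n j)" for l :: "'n \<Rightarrow> int" and n :: nat
  have expand: "(\<Prod>j\<in>UNIV. \<Sum>l\<in>{-m..m}. of_real (g j l) * char1 (of_int l * x n j)) = (\<Sum>l\<in>L. of_real (c l) * e l n)" for n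
    unfolding L_def c_def e_def by (subst prod_sum_PiE) (auto simp: prod.distrib char1_sum)
  \<comment> \<open>The entries of \<open>l - k\<close> reach \<open>2 * m\<close>, which is why the
    hypothesis concerns a box twice as wide as the frequencies. For \<open>l\<close> different from
    \<open>k\<close> the sum runs over all powers of an N-th root of unity other than 1; the offset
    \<open>y\<close> contributes only a phase that factors out.\<close>
  have orth: "(\<Sum>n<N. e l n * cnj (e k n)) = (if l = k then of_nat N else 0)" if "l \<in> L" "k \<in> L" for l k
  proof -
    define w where "w = (\<Sum>j\<in>UNIV. (l j - k j) * z j)"
    have "e l n * cnj (e k n) = char1 (\<Sum>j\<in>UNIV. of_int (l j - k j) * y j) * char1 (real n * of_int w / real N)" for n
    proof -
      have "e l n * cnj (e k n) = char1 ((\<Sum>j\<in>UNIV. of_int (l j) * x n j) + - (\<Sum>j\<in>UNIV. of_int (k j) * x n j))"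
        unfolding e_def char1_add char1_minus ..
      also have "(\<Sum>j\<in>UNIV. of_int (l j) * x n j) + - (\<Sum>j\<in>UNIV. of_int (k j) * x n j) =
          (\<Sum>j\<in>UNIV. of_int (l j - k j) * x n j)"
        by (simp add: sum_subtractf left_diff_distrib)
      also have "\<dots> = (\<Sum>j\<in>UNIV. of_int (l j - k j) * y j) + real n * of_int w / real N"
        unfolding w_def x_def
        by (simp add: distrib_left sum.distrib sum_distrib_left sum_divide_distrib mult_ac)
      finally show ?thesis by (simp add: char1_add)
    qed
    then have eq: "(\<Sum>n<N. e l n * cnj (e k n)) =
        char1 (\<Sum>j\<in>UNIV. of_int (l j - k j) * y j) * (\<Sum>n<N. char1 (real n * of_int w / real N))"
      by (simp add: sum_distrib_left)
    show ?thesis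
    proof (cases "l = k")
      case True
      then show ?thesis unfolding eq by (simp add: w_def char1_def)
    next
      case False
      then have "\<exists>j. l j - k j \<noteq> 0" by (auto simp: fun_eq_iff)
      moreover have "\<bar>l j - k j\<bar> \<le> 2 * m" for j
      proof -
        have "l j \<in> {-m..m}" "k j \<in> {-m..m}" using that unfolding L_def by (auto dest: PiE_mem)
        then show ?thesis by auto
      qed
      ultimately have "\<not> int N dvd w" unfolding w_def by (intro dual) auto
      then show ?thesis unfolding eq using sum_char1_eq_0[OF \<open>N > 0\<close>] False by simp
    qed
  qed
  have "complex_of_real (\<Sum>n<N. (cmod (\<Sum>l\<in>L. of_real (c l) * e l n))\<^sup>2) =
     (\<Sum>n<N. (\<Sum>l\<in>L. of_real (c l) * e l n) * cnj (\<Sum>k\<in>L. of_real (c k) * e k n))"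
    by (simp only: of_real_sum complex_norm_square)
  also have "\<dots> = (\<Sum>n<N. \<Sum>l\<in>L. \<Sum>k\<in>L. of_real (c l) * of_real (c k) * (e l n * cnj (e k n)))"
    by (simp add: sum_product mult_ac)
  also have "\<dots> = (\<Sum>l\<in>L. \<Sum>k\<in>L. \<Sum>n<N. of_real (c l) * of_real (c k) * (e l n * cnj (e k n)))"
    by (subst sum.swap, intro sum.cong refl, rule sum.swap)
  also have "\<dots> = (\<Sum>l\<in>L. \<Sum>k\<in>L. of_real (c l) * of_real (c k) * (if l = k then of_nat N else 0))"
    by (simp add: sum_distrib_left[symmetric] orth)
  also have "\<dots> = (\<Sum>l\<in>L. of_real (c l) * of_real (c l) * of_nat N)"
    using \<open>finite L\<close> by (intro sum.cong refl) (simp add: if_distrib cong: if_cong)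
  also have "\<dots> = complex_of_real (real N * (\<Sum>l\<in>L. (c l)\<^sup>2))"
    by (simp add: sum_distrib_left power2_eq_square mult_ac)
  finally have "(\<Sum>n<N. (cmod (\<Sum>l\<in>L. of_real (c l) * e l n))\<^sup>2) = real N * (\<Sum>l\<in>L. (c l)\<^sup>2)"
    by (simp only: of_real_eq_iff)
  moreover have "(\<Sum>l\<in>L. (c l)\<^sup>2) = (\<Prod>j\<in>UNIV. \<Sum>l\<in>{-m..m}. (g j l)\<^sup>2)"
    unfolding L_def c_def by (subst prod_sum_PiE) (auto simp: prod_power_distrib)
  ultimately show ?thesis
    unfolding expand[symmetric] by (simp add: prod_norm[symmetric] prod_power_distrib x_def)
qed

text \<open>A crude form of Jordan's inequality: on |x| <= 2 the cubic Taylor remainder is at most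
  2|x|/3, leaving |sin x| >= |x|/3, and 3 < pi < 4 does the rest.\<close>

lemma abs_le_abs_sin_pi:
  assumes "\<bar>v\<bar> \<le> 1 / 2"
  shows "\<bar>v\<bar> \<le> \<bar>sin (pi * v)\<bar>"
proof -
  define x where "x = pi * v"
  have "\<bar>x\<bar> \<le> 2"
    using assms pi_less_4 mult_mono[of pi 4 "\<bar>v\<bar>" "1 / 2"] by (simp add: x_def abs_mult)
  then have "\<bar>x\<bar>\<^sup>2 \<le> 2\<^sup>2" by (intro power_mono) auto
  then have "\<bar>x\<bar> * \<bar>x\<bar>\<^sup>2 \<le> \<bar>x\<bar> * 4" by (intro mult_left_mono) auto
  then have "\<bar>x\<bar> ^ 3 \<le> 4 * \<bar>x\<bar>" by (simp add: power3_eq_cube power2_eq_square mult.assoc)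
  moreover have "\<bar>sin x - x\<bar> \<le> \<bar>x\<bar> ^ 3 / 6"
    using Maclaurin_sin_bound[of x 3]
    by (simp add: eval_nat_numeral sin_coeff_def fact_numeral inverse_eq_divide)
  ultimately have "\<bar>x\<bar> / 3 \<le> \<bar>sin x\<bar>" by linarith
  moreover have "\<bar>v\<bar> * 3 \<le> \<bar>x\<bar>"
    using pi_gt3 mult_left_mono[of 3 pi "\<bar>v\<bar>"] by (simp add: x_def abs_mult mult.commute)
  ultimately show ?thesis unfolding x_def by linarith
qed

text \<open>|1 - e(t)| = 2 |sin(pi v)|, where v is the signed distance of t from its nearest
  integer.\<close>

lemma norm_1_minus_char1_ge: "4 * (dist_int t)\<^sup>2 \<le> (cmod (1 - char1 t))\<^sup>2"
proof -
  define v where "v = t - of_int (round t)"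
  have "char1 t = char1 (v + of_int (round t))" by (simp add: v_def)
  also have "\<dots> = char1 v" unfolding char1_add by simp
  finally have "(cmod (1 - char1 t))\<^sup>2 = (1 - cos (2 * (pi * v)))\<^sup>2 + (sin (2 * (pi * v)))\<^sup>2"
    by (simp add: char1_def cmod_power2 mult.assoc)
  also have "\<dots> = 4 * (sin (pi * v))\<^sup>2"
    unfolding sin_double cos_double_sin using sin_cos_squared_add[of "pi * v"] by algebra
  finally have eq: "(cmod (1 - char1 t))\<^sup>2 = 4 * (sin (pi * v))\<^sup>2" .
  have "\<bar>v\<bar> \<le> \<bar>sin (pi * v)\<bar>"
    using of_int_round_abs_le[of t] by (intro abs_le_abs_sin_pi) (simp add: v_def abs_minus_commute)
  then have "v\<^sup>2 \<le> (sin (pi * v))\<^sup>2" by (simp add: abs_le_square_iff)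
  then show ?thesis unfolding eq by (simp add: dist_int_eq_round v_def)
qed

text \<open>The Fourier coefficients of m times the Fejer kernel. The triangle is used because its
  squares sum to order m^3 but those of its consecutive differences only to order m.\<close>

definition hat :: "int \<Rightarrow> int \<Rightarrow> real" where
  "hat m l = of_int (max 0 (m - \<bar>l\<bar>))"

text \<open>Summation by parts. No boundary terms arise, since \<open>hat m\<close> vanishes at
  \<open>m\<close> and at \<open>-m - 1\<close>; this lets the shifted range be replaced by the
  original one.\<close>

lemma hat_difference:
  assumes "m \<ge> 0"
  shows "(1 - char1 t) * (\<Sum>l\<in>{-m..m}. of_real (hat m l) * char1 (of_int l * t)) =
    (\<Sum>l\<in>{-m..m}. of_real (hat m l - hat m (l - 1)) * char1 (of_int l * t))"
proof -
  have "char1 t * (\<Sum>l\<in>{-m..m}. of_real (hat m l) * char1 (of_int l * t)) =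
      (\<Sum>l\<in>{-m..m}. of_real (hat m l) * char1 (of_int (l + 1) * t))"
    unfolding sum_distrib_left
  proof (intro sum.cong refl)
    fix l
    have "char1 (of_int (l + 1) * t) = char1 (of_int l * t + t)" by (simp add: algebra_simps)
    then show "char1 t * (of_real (hat m l) * char1 (of_int l * t)) = of_real (hat m l) * char1 (of_int (l + 1) * t)"
      by (simp add: char1_add)
  qed
  also have "\<dots> = (\<Sum>l\<in>{-m+1..m+1}. of_real (hat m (l - 1)) * char1 (of_int l * t))"
    by (rule sum.reindex_bij_witness[of _ "\<lambda>l. l - 1" "\<lambda>l. l + 1"]) auto
  also have "\<dots> = (\<Sum>l\<in>{-m..m+1}. of_real (hat m (l - 1)) * char1 (of_int l * t))"
    by (rule sum.mono_neutral_left) (auto simp: hat_def)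
  also have "\<dots> = (\<Sum>l\<in>{-m..m}. of_real (hat m (l - 1)) * char1 (of_int l * t))"
    by (rule sum.mono_neutral_right) (auto simp: hat_def)
  finally show ?thesis
    by (simp add: left_diff_distrib sum_subtractf)
qed

lemma sum_hat_difference_sq_le:
  assumes "m \<ge> 0"
  shows "(\<Sum>l\<in>{-m..m}. (hat m l - hat m (l - 1))\<^sup>2) \<le> 2 * of_int m + 1"
proof -
  have "(\<Sum>l\<in>{-m..m}. (hat m l - hat m (l - 1))\<^sup>2) \<le> (\<Sum>l\<in>{-m..m}. 1)"
  proof (rule sum_mono)
    fix l
    have "\<bar>max 0 (m - \<bar>l\<bar>) - max 0 (m - \<bar>l - 1\<bar>)\<bar> \<le> 1" by linarith
    then have "\<bar>hat m l - hat m (l - 1)\<bar> \<le> 1" unfolding hat_def by linarith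
    then show "(hat m l - hat m (l - 1))\<^sup>2 \<le> 1" by (simp add: abs_square_le_1)
  qed
  then show ?thesis using assms by simp
qed

text \<open>Only the middle frequencies |l| <= q are kept; there are 2q + 1 of them and
  \<open>hat\<close> is at least q on each.\<close>

lemma sum_hat_sq_ge:
  "2 * real q ^ 3 \<le> (\<Sum>l\<in>{-2 * int q..2 * int q}. (hat (2 * int q) l)\<^sup>2)"
proof -
  have "2 * real q ^ 3 \<le> (\<Sum>l\<in>{-int q..int q}. (real q)\<^sup>2)"
    by (simp add: power3_eq_cube power2_eq_square algebra_simps)
  also have "\<dots> \<le> (\<Sum>l\<in>{-int q..int q}. (hat (2 * int q) l)\<^sup>2)"
  proof (intro sum_mono power_mono)
    fix l assume "l \<in> {-int q..int q}"
    then have "int q \<le> max 0 (2 * int q - \<bar>l\<bar>)" by auto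
    then show "real q \<le> hat (2 * int q) l" unfolding hat_def by linarith
  qed auto
  also have "\<dots> \<le> (\<Sum>l\<in>{-2 * int q..2 * int q}. (hat (2 * int q) l)\<^sup>2)"
    by (rule sum_mono2) auto
  finally show ?thesis .
qed

text \<open>If every point of the coset were at distance at least \<open>d / q\<close> from the integers in some
  coordinate, then \<open>\<Sum>\<^sub>j |1 - e(x\<^sub>j)|\<^sup>2\<close> would be bounded below there. But its average against \<open>|P|\<^sup>2\<close>, for \<open>P\<close>
  a product of trigonometric polynomials with hat function coefficients, is too small, since
  multiplication by \<open>1 - e(x\<^sub>j)\<close> differences the coefficients.\<close>

lemma lattice_covering:
  fixes y :: "'n::finite \<Rightarrow> real" and z :: "'n \<Rightarrow> int"
  assumes "N > 0" "q > 0"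
    and dual: "\<And>h. (\<exists>j. h j \<noteq> 0) \<Longrightarrow> (\<forall>j. \<bar>h j\<bar> \<le> 4 * int q) \<Longrightarrow> \<not> int N dvd (\<Sum>j\<in>UNIV. h j * z j)"
  shows "\<exists>n<N. \<forall>j. dist_int (y j + real n * of_int (z j) / real N) < real CARD('n) / real q"
proof (rule ccontr)
  define d where "d = real CARD('n)"
  have "d \<ge> 1" unfolding d_def by (simp add: Suc_le_eq)
  \<comment> \<open>Differences of frequencies in the box then reach \<open>2 * m = 4 * q\<close>,
    the range of the hypothesis \<open>dual\<close>.\<close>
  define m where "m = 2 * int q"
  define x where "x n j = y j + real n * of_int (z j) / real N" for n j
  assume "\<not> ?thesis"
  then have far: "\<exists>j. d / real q \<le> dist_int (x n j)" if "n < N" for n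
    using that unfolding x_def d_def by (meson not_less)
  define P where "P n = (\<Prod>j\<in>UNIV. (cmod (\<Sum>l\<in>{-m..m}. of_real (hat m l) * char1 (of_int l * x n j)))\<^sup>2)" for n
  have "P n \<ge> 0" for n unfolding P_def by (intro prod_nonneg) auto
  define S where "S = (\<Sum>l\<in>{-m..m}. (hat m l)\<^sup>2)"
  define D where "D = (\<Sum>l\<in>{-m..m}. (hat m l - hat m (l - 1))\<^sup>2)"
  have S: "2 * real q ^ 3 \<le> S" using sum_hat_sq_ge[of q] by (simp add: S_def m_def)
  have "S > 0" using \<open>q > 0\<close> by (intro less_le_trans[OF _ S]) auto
  have D: "D \<le> 5 * real q"
    using sum_hat_difference_sq_le[of m] \<open>q > 0\<close> unfolding D_def m_def by simp
  have dual': "\<not> int N dvd (\<Sum>j\<in>UNIV. h j * z j)" if "\<exists>j. h j \<noteq> 0" "\<forall>j. \<bar>h j\<bar> \<le> 2 * m" for h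
    using dual that by (simp add: m_def)
  have sum_P: "(\<Sum>n<N. P n) = real N * S ^ CARD('n)"
    unfolding P_def x_def S_def
    by (subst lattice_Parseval[OF \<open>N > 0\<close> dual']) auto
  \<comment> \<open>Multiplying by \<open>1 - char1 (x n i)\<close> changes the coefficients in
    coordinate \<open>i\<close> alone, from \<open>hat\<close> to its differences. Parseval
    therefore gives the sum of \<open>P\<close> with one factor \<open>S\<close> replaced by
    \<open>D\<close>.\<close>
  have sum_shift: "(\<Sum>n<N. (cmod (1 - char1 (x n i)))\<^sup>2 * P n) = real N * (D * S ^ (CARD('n) - 1))" for i
  proof -
    define g where "g j l = (if j = i then hat m l - hat m (l - 1) else hat m l)" for j l
    have "(cmod (1 - char1 (x n i)))\<^sup>2 * P n =
        (\<Prod>j\<in>UNIV. (cmod (\<Sum>l\<in>{-m..m}. of_real (g j l) * char1 (of_int l * x n j)))\<^sup>2)" for n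
    proof -
      have "(cmod (1 - char1 (x n i)))\<^sup>2 * P n = (\<Prod>j\<in>UNIV. (if j = i then (cmod (1 - char1 (x n i)))\<^sup>2 else 1) *
        (cmod (\<Sum>l\<in>{-m..m}. of_real (hat m l) * char1 (of_int l * x n j)))\<^sup>2)"
        unfolding prod.distrib P_def by simp
      also have "\<dots> = (\<Prod>j\<in>UNIV. (cmod (\<Sum>l\<in>{-m..m}. of_real (g j l) * char1 (of_int l * x n j)))\<^sup>2)"
      proof (intro prod.cong refl)
        fix j
        show "(if j = i then (cmod (1 - char1 (x n i)))\<^sup>2 else 1) *
            (cmod (\<Sum>l\<in>{-m..m}. of_real (hat m l) * char1 (of_int l * x n j)))\<^sup>2 =
          (cmod (\<Sum>l\<in>{-m..m}. of_real (g j l) * char1 (of_int l * x n j)))\<^sup>2"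
        proof (cases "j = i")
          case True
          have "m \<ge> 0" by (simp add: m_def)
          show ?thesis
            unfolding True g_def using hat_difference[OF \<open>m \<ge> 0\<close>, of "x n i", symmetric]
            by (simp add: norm_mult power_mult_distrib)
        qed (simp add: g_def)
      qed
      finally show ?thesis .
    qed
    then have "(\<Sum>n<N. (cmod (1 - char1 (x n i)))\<^sup>2 * P n) = real N * (\<Prod>j\<in>UNIV. \<Sum>l\<in>{-m..m}. (g j l)\<^sup>2)"
      unfolding x_def using lattice_Parseval[OF \<open>N > 0\<close> dual'] by simp
    also have "(\<Prod>j\<in>UNIV. \<Sum>l\<in>{-m..m}. (g j l)\<^sup>2) = D * (\<Prod>j\<in>UNIV - {i}. \<Sum>l\<in>{-m..m}. (g j l)\<^sup>2)"
      by (subst prod.remove[of _ i]) (auto simp: g_def D_def)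
    also have "(\<Prod>j\<in>UNIV - {i}. \<Sum>l\<in>{-m..m}. (g j l)\<^sup>2) = (\<Prod>j\<in>UNIV - {i}. S)"
      by (intro prod.cong) (auto simp: g_def S_def)
    finally show ?thesis by (simp add: card_Diff_singleton)
  qed
  have "4 * (d / real q)\<^sup>2 * (real N * S ^ CARD('n)) = (\<Sum>n<N. 4 * (d / real q)\<^sup>2 * P n)"
    by (simp add: sum_P[symmetric] sum_distrib_left)
  also have "\<dots> \<le> (\<Sum>n<N. \<Sum>i\<in>UNIV. (cmod (1 - char1 (x n i)))\<^sup>2 * P n)"
  proof (rule sum_mono)
    fix n assume "n \<in> {..<N}"
    then obtain i where i: "d / real q \<le> dist_int (x n i)" using far by auto
    have "4 * (d / real q)\<^sup>2 \<le> 4 * (dist_int (x n i))\<^sup>2"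
      using i \<open>d \<ge> 1\<close> by (intro mult_left_mono power_mono) auto
    also have "\<dots> \<le> (cmod (1 - char1 (x n i)))\<^sup>2" by (rule norm_1_minus_char1_ge)
    also have "\<dots> \<le> (\<Sum>i\<in>UNIV. (cmod (1 - char1 (x n i)))\<^sup>2)"
      by (rule member_le_sum) auto
    finally show "4 * (d / real q)\<^sup>2 * P n \<le> (\<Sum>i\<in>UNIV. (cmod (1 - char1 (x n i)))\<^sup>2 * P n)"
      unfolding sum_distrib_right[symmetric] using \<open>P n \<ge> 0\<close> by (rule mult_right_mono)
  qed
  also have "\<dots> = (\<Sum>i\<in>(UNIV::'n set). real N * (D * S ^ (CARD('n) - 1)))"
    by (subst sum.swap) (simp add: sum_shift)
  also have "\<dots> = real N * (d * D * S ^ (CARD('n) - 1))" by (simp add: d_def)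
  finally have "real N * S ^ (CARD('n) - 1) * (4 * (d / real q)\<^sup>2 * S) \<le> real N * S ^ (CARD('n) - 1) * (d * D)"
    by (subst (asm) power_eq_if) (auto simp: mult_ac)
  then have "4 * (d / real q)\<^sup>2 * S \<le> d * D"
    using \<open>N > 0\<close> \<open>S > 0\<close> by (simp add: mult_le_cancel_left_pos)
  moreover have "4 * (d / real q)\<^sup>2 * (2 * real q ^ 3) \<le> 4 * (d / real q)\<^sup>2 * S"
    by (rule mult_left_mono[OF S]) auto
  moreover have "d * D \<le> d * (5 * real q)" using D \<open>d \<ge> 1\<close> by (intro mult_left_mono) auto
  ultimately have "4 * (d / real q)\<^sup>2 * (2 * real q ^ 3) \<le> d * (5 * real q)" by linarith
  \<comment> \<open>As \<open>S\<close> has order q^3 and \<open>D\<close> order q, the radius d / q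
    makes the powers of q cancel. What remains is 8 d <= 5, contradicting d >= 1.\<close>
  moreover have "4 * (d / real q)\<^sup>2 * (2 * real q ^ 3) = (8 * d) * (d * real q)"
    using \<open>q > 0\<close> by (simp add: field_simps power2_eq_square power3_eq_cube)
  ultimately have "(8 * d) * (d * real q) \<le> 5 * (d * real q)" by simp
  then show False using \<open>d \<ge> 1\<close> \<open>q > 0\<close> by (simp add: mult_le_cancel_right)
qed

section \<open>Volumes of parallel bodies\<close>

lemma convex_line_between:
  fixes x e :: "'a::real_vector"
  assumes "convex K" "x - u *\<^sub>R e \<in> K" "x + v *\<^sub>R e \<in> K" "u \<ge> 0" "v \<ge> 0"
  shows "x \<in> K"
proof (cases "u + v = 0")
  case True
  then have "u = 0" using assms(4,5) by linarith
  then show ?thesis using assms(2) by simp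
next
  case False
  then have pos: "u + v > 0" using assms by auto
  have "(v / (u + v)) *\<^sub>R (x - u *\<^sub>R e) + (u / (u + v)) *\<^sub>R (x + v *\<^sub>R e) \<in> K"
    using assms pos by (intro convexD) (auto simp: add_divide_distrib[symmetric] add.commute)
  also have "(v / (u + v)) *\<^sub>R (x - u *\<^sub>R e) + (u / (u + v)) *\<^sub>R (x + v *\<^sub>R e) =
      (v / (u + v) + u / (u + v)) *\<^sub>R x"
    by (simp add: algebra_simps)
  also have "\<dots> = x" using pos by (simp add: add_divide_distrib[symmetric] add.commute)
  finally show ?thesis .
qed

text \<open>About \<open>1 / s\<close> translates of \<open>B\<close> by multiples of \<open>s\<close> along axis \<open>j\<close> fit disjointly into a box of side 3.\<close>

lemma measure_le_of_disjoint_translates: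
  fixes B :: "(real^'n::finite) set"
  assumes B: "B \<in> lmeasurable" "\<And>x i. x \<in> B \<Longrightarrow> 0 \<le> x $ i \<and> x $ i \<le> 2"
    and s: "0 < s" "s \<le> 1"
    and sep: "\<And>x m. x \<in> B \<Longrightarrow> x + (real (Suc m) * s) *\<^sub>R axis j 1 \<notin> B"
  shows "measure lebesgue B \<le> 2 * s * 3 ^ CARD('n)"
proof -
  \<comment> \<open>The translates move by at most \<open>n * s <= 1\<close>, hence the box of side
    3; and \<open>s <= 1\<close> gives \<open>1 / s <= 2 * n\<close>, the origin of the factor
    2.\<close>
  define n where "n = nat \<lfloor>1 / s\<rfloor>"
  have "1 / s \<ge> 1" using s by simp
  then have "1 \<le> \<lfloor>1 / s\<rfloor>" by linarith
  with \<open>1 / s \<ge> 1\<close> have n: "real n \<le> 1 / s" "1 / s < real n + 1" "real n \<ge> 1"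
    unfolding n_def by linarith+
  have ns: "real n * s \<le> 1" using n(1) s by (simp add: field_simps)
  have ns2: "1 \<le> 2 * s * real n"
  proof -
    have "1 / s \<le> 2 * real n" using n by linarith
    then show ?thesis using s by (simp add: field_simps)
  qed
  define T where "T i = (+) ((real i * s) *\<^sub>R axis j 1) ` B" for i :: nat
  have T: "T i \<in> lmeasurable" "measure lebesgue (T i) = measure lebesgue B" for i
    unfolding T_def using B(1) by (auto simp: measurable_translation measure_translation)
  have disj: "T i \<inter> T k = {}" if "i < k" for i k
  proof (rule ccontr)
    assume "T i \<inter> T k \<noteq> {}"
    then obtain x x' where x: "x \<in> B" "x' \<in> B"
      and eq: "(real i * s) *\<^sub>R axis j 1 + x' = (real k * s) *\<^sub>R axis j 1 + x"
      by (auto simp: T_def)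
    have "x' = x + ((real k - real i) * s) *\<^sub>R axis j 1"
      using eq by (simp add: algebra_simps)
    moreover have "real k - real i = real (Suc (k - Suc i))" using that by auto
    ultimately show False using sep[OF x(1)] x(2) by metis
  qed
  have "real n * measure lebesgue B = (\<Sum>i<n. measure lebesgue (T i))" by (simp add: T)
  also have "\<dots> = measure lebesgue (\<Union>i<n. T i)"
  proof (rule measure_UNION'[symmetric])
    show "pairwise (\<lambda>i j. disjnt (T i) (T j)) {..<n}"
      unfolding pairwise_def disjnt_def using disj by (metis inf_commute linorder_neqE_nat)
  qed (auto simp: T)
  also have "\<dots> \<le> measure lebesgue (cbox 0 (\<chi> i. 3) :: (real^'n) set)"
  proof (rule measure_mono_fmeasurable)
    show "(\<Union>i<n. T i) \<subseteq> cbox 0 (\<chi> i. 3)"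
    proof (clarsimp simp: T_def mem_box_cart)
      fix i x k assume i: "i < n" and x: "x \<in> B"
      have "real i * s \<le> 1" using i s ns mult_right_mono[of "real i" "real n" s] by linarith
      then show "0 \<le> real i * s * axis j 1 $ k + x $ k \<and> real i * s * axis j 1 $ k + x $ k \<le> 3"
        using B(2)[OF x, of k] s by (auto simp: axis_def)
    qed
    show "(\<Union>i<n. T i) \<in> sets lebesgue" using T by blast
  qed auto
  also have "\<dots> = 3 ^ CARD('n)"
  proof -
    have "cbox 0 (\<chi> i. 3) \<noteq> ({} :: (real^'n) set)"
      by (auto simp: interval_ne_empty_cart)
    then show ?thesis by (simp add: content_cbox_cart)
  qed
  finally have "2 * s * (real n * measure lebesgue B) \<le> 2 * s * 3 ^ CARD('n)"
    using s by (intro mult_left_mono) auto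
  moreover have "1 * measure lebesgue B \<le> (2 * s * real n) * measure lebesgue B"
    using ns2 by (intro mult_right_mono) auto
  ultimately show ?thesis by simp
qed

lemma bounded_of_coordinate_bounds:
  fixes K :: "(real^'n::finite) set"
  assumes "\<And>x i. x \<in> K \<Longrightarrow> 0 \<le> x $ i \<and> x $ i \<le> 2"
  shows "bounded K"
  using assms by (intro bounded_subset[OF bounded_cbox[of 0 "\<chi> i. 2"]]) (auto simp: mem_box_cart)

text \<open>On a line in direction \<open>j\<close> the set \<open>K' - K\<close> is a short piece
  just beyond \<open>K\<close>. If it also contained x moved forward by a positive multiple of s,
  then x would have a point of \<open>K\<close> behind it and another one at or ahead of it, because
  the endpoint overshoots \<open>K\<close> by at most s; convexity would put x into
  \<open>K\<close>. So the translates of \<open>K' - K\<close> are disjoint.\<close>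

lemma measure_outer_step:
  fixes K :: "(real^'n::finite) set"
  assumes "convex K" "\<And>x i. x \<in> K \<Longrightarrow> 0 \<le> x $ i \<and> x $ i \<le> 2"
    and s: "0 < s" "s \<le> 1"
    and K': "K' = {x + t *\<^sub>R axis j 1 |x t. x \<in> K \<and> 0 \<le> t \<and> t \<le> s}"
    and bd: "\<And>x i. x \<in> K' \<Longrightarrow> 0 \<le> x $ i \<and> x $ i \<le> 2"
  shows "convex K' \<and> measure lebesgue K' \<le> measure lebesgue K + 2 * s * 3 ^ CARD('n)"
proof
  have "K' = (\<Union>x\<in>K. \<Union>y\<in>(\<lambda>t. t *\<^sub>R axis j 1) ` {0..s}. {x + y})"
    unfolding K' by fastforce
  moreover have "convex ((\<lambda>t. t *\<^sub>R axis j 1 :: real^'n) ` {0..s})"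
    by (intro convex_linear_image linear_scaleR_left) auto
  ultimately show "convex K'"
    using convex_sums[OF \<open>convex K\<close>] by metis
  have "K \<subseteq> K'" unfolding K' using s by force
  have meas: "K \<in> lmeasurable" "K' \<in> lmeasurable"
    using \<open>convex K\<close> \<open>convex K'\<close> assms(2) bd by (auto intro!: measurable_convex bounded_of_coordinate_bounds)
  have "measure lebesgue (K' - K) \<le> 2 * s * 3 ^ CARD('n)"
  proof (rule measure_le_of_disjoint_translates[where j = j])
    show "K' - K \<in> lmeasurable" using meas by blast
    fix x and m :: nat assume x: "x \<in> K' - K"
    show "x + (real (Suc m) * s) *\<^sub>R axis j 1 \<notin> K' - K"
    proof
      assume "x + (real (Suc m) * s) *\<^sub>R axis j 1 \<in> K' - K"
      then obtain k v where k: "k \<in> K" "0 \<le> v" "v \<le> s"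
          "x + (real (Suc m) * s) *\<^sub>R axis j 1 = k + v *\<^sub>R axis j 1"
        unfolding K' by blast
      obtain k' u where k': "k' \<in> K" "0 \<le> u" "x = k' + u *\<^sub>R axis j 1"
        using x unfolding K' by blast
      have "x - u *\<^sub>R axis j 1 = k'" using k'(3) by simp
      then have left: "x - u *\<^sub>R axis j 1 \<in> K" using k'(1) by (simp only:)
      have "x + (real (Suc m) * s - v) *\<^sub>R axis j 1 = k"
        using k(4) by (simp add: algebra_simps)
      then have right: "x + (real (Suc m) * s - v) *\<^sub>R axis j 1 \<in> K" using k(1) by (simp only:)
      have "1 * s \<le> real (Suc m) * s"
        using s by (intro mult_right_mono) auto
      then have "real (Suc m) * s - v \<ge> 0" using k(3) by linarith
      then have "x \<in> K"
        by (rule convex_line_between[OF \<open>convex K\<close> left right k'(2)])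
      then show False using x by simp
    qed
  qed (use bd s in auto)
  moreover have "measure lebesgue (K' - K) = measure lebesgue K' - measure lebesgue K"
    using meas \<open>K \<subseteq> K'\<close> by (intro measurable_measure_Diff) auto
  ultimately show "measure lebesgue K' \<le> measure lebesgue K + 2 * s * 3 ^ CARD('n)" by simp
qed

text \<open>Same mechanism: if x and a point of the line at least s further on lie in
  \<open>K\<close>, then x + s e_j lies between them, so x was not removed.\<close>

lemma measure_inner_step:
  fixes K :: "(real^'n::finite) set"
  assumes "convex K" and bd: "\<And>x i. x \<in> K \<Longrightarrow> 0 \<le> x $ i \<and> x $ i \<le> 2"
    and s: "0 < s" "s \<le> 1"
    and K': "K' = {x \<in> K. x + s *\<^sub>R axis j 1 \<in> K}"
  shows "convex K' \<and> measure lebesgue K \<le> measure lebesgue K' + 2 * s * 3 ^ CARD('n)"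
proof
  have "K' = K \<inter> (+) (- s *\<^sub>R axis j 1) ` K"
    unfolding K' by (force simp: image_iff algebra_simps)
  then show "convex K'"
    using \<open>convex K\<close> by (simp add: convex_Int convex_translation)
  have "K' \<subseteq> K" unfolding K' by auto
  have meas: "K \<in> lmeasurable" "K' \<in> lmeasurable"
    using \<open>convex K\<close> \<open>convex K'\<close> bd \<open>K' \<subseteq> K\<close> by (auto intro!: measurable_convex bounded_of_coordinate_bounds)
  have "measure lebesgue (K - K') \<le> 2 * s * 3 ^ CARD('n)"
  proof (rule measure_le_of_disjoint_translates[where j = j])
    show "K - K' \<in> lmeasurable" using meas by blast
    fix x and m :: nat assume x: "x \<in> K - K'"
    show "x + (real (Suc m) * s) *\<^sub>R axis j 1 \<notin> K - K'"
    proof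
      assume "x + (real (Suc m) * s) *\<^sub>R axis j 1 \<in> K - K'"
      then have "(x + s *\<^sub>R axis j 1) + (real m * s) *\<^sub>R axis j 1 \<in> K"
        by (simp add: algebra_simps)
      moreover have "(x + s *\<^sub>R axis j 1) - s *\<^sub>R axis j 1 \<in> K" using x by simp
      ultimately have "x + s *\<^sub>R axis j 1 \<in> K"
        using convex_line_between[OF \<open>convex K\<close>] s by (metis less_eq_real_def mult_nonneg_nonneg of_nat_0_le_iff)
      then show False using x unfolding K' by auto
    qed
  qed (use bd s in auto)
  moreover have "measure lebesgue (K - K') = measure lebesgue K - measure lebesgue K'"
    using meas \<open>K' \<subseteq> K\<close> by (intro measurable_measure_Diff) auto
  ultimately show "measure lebesgue K \<le> measure lebesgue K' + 2 * s * 3 ^ CARD('n)" by simp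
qed

text \<open>The Minkowski sum with [0, s]^d is built one axis at a time, each step keeping convexity
  and costing at most 2 s 3^d in volume. The induction over \<open>J\<close> tracks which
  coordinates have been enlarged: those may reach 2, the others still at most 1, so with s <= 1
  every step stays inside the box [0, 2]^d.\<close>

lemma outer_parallel_body:
  fixes C :: "(real^'n::finite) set"
  assumes "convex C" "\<And>x i. x \<in> C \<Longrightarrow> 0 \<le> x $ i \<and> x $ i \<le> 1" "0 < s" "s \<le> 1"
  obtains K where "convex K" "\<And>x i. x \<in> K \<Longrightarrow> 0 \<le> x $ i \<and> x $ i \<le> 2"
    "measure lebesgue K \<le> measure lebesgue C + real CARD('n) * (2 * s * 3 ^ CARD('n))"
    "\<And>x v. x \<in> C \<Longrightarrow> (\<And>i. 0 \<le> v $ i \<and> v $ i \<le> s) \<Longrightarrow> x + v \<in> K"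
proof -
  have "\<exists>K. convex K \<and> (\<forall>x\<in>K. \<forall>i. 0 \<le> x $ i \<and> x $ i \<le> (if i \<in> J then 2 else 1)) \<and>
      measure lebesgue K \<le> measure lebesgue C + real (card J) * (2 * s * 3 ^ CARD('n)) \<and>
      (\<forall>x\<in>C. \<forall>v. (\<forall>i. 0 \<le> v $ i \<and> v $ i \<le> s) \<longrightarrow> (\<forall>i. i \<notin> J \<longrightarrow> v $ i = 0) \<longrightarrow> x + v \<in> K)"
    if "finite J" for J :: "'n set"
    using that
  proof (induction rule: finite_induct)
    case empty
    have "x + v \<in> C" if "x \<in> C" "\<forall>i. v $ i = 0" for x v
    proof -
      have "v = 0" using that(2) by (simp add: vec_eq_iff)
      then show ?thesis using that(1) by simp
    qed
    then show ?case using assms by (intro exI[of _ C]) auto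
  next
    case (insert j J)
    then obtain K where K: "convex K" "\<forall>x\<in>K. \<forall>i. 0 \<le> x $ i \<and> x $ i \<le> (if i \<in> J then 2 else 1)"
      "measure lebesgue K \<le> measure lebesgue C + real (card J) * (2 * s * 3 ^ CARD('n))"
      "\<forall>x\<in>C. \<forall>v. (\<forall>i. 0 \<le> v $ i \<and> v $ i \<le> s) \<longrightarrow> (\<forall>i. i \<notin> J \<longrightarrow> v $ i = 0) \<longrightarrow> x + v \<in> K"
      by blast
    define K' where "K' = {x + t *\<^sub>R axis j 1 |x t. x \<in> K \<and> 0 \<le> t \<and> t \<le> s}"
    have bd: "0 \<le> x $ i \<and> x $ i \<le> (if i \<in> insert j J then 2 else 1)" if x: "x \<in> K'" for x i
    proof -
      obtain k t where k: "x = k + t *\<^sub>R axis j 1" "k \<in> K" "0 \<le> t" "t \<le> s"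
        using x unfolding K'_def by blast
      then show ?thesis using K(2)[rule_format, OF k(2), of i] insert.hyps(2) assms(4)
        by (auto simp: axis_def split: if_splits)
    qed
    have bd2: "0 \<le> x $ i \<and> x $ i \<le> 2" if "x \<in> K'" for x i
      using bd[OF that, of i] by (auto split: if_splits)
    have bd3: "0 \<le> x $ i \<and> x $ i \<le> 2" if "x \<in> K" for x i
      using K(2)[rule_format, OF that, of i] by (auto split: if_splits)
    have step: "convex K'" "measure lebesgue K' \<le> measure lebesgue K + 2 * s * 3 ^ CARD('n)"
      using measure_outer_step[OF K(1) bd3 assms(3,4) K'_def bd2] by auto
    have "x + v \<in> K'" if x: "x \<in> C" and v: "\<forall>i. 0 \<le> v $ i \<and> v $ i \<le> s" "\<forall>i. i \<notin> insert j J \<longrightarrow> v $ i = 0" for x v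
    proof -
      define v' where "v' = v - v $ j *\<^sub>R axis j 1"
      have v': "v' $ i = (if i = j then 0 else v $ i)" for i by (auto simp: v'_def axis_def)
      have "x + v' \<in> K"
        using K(4)[rule_format, OF x, of v'] v assms(3) by (auto simp: v')
      moreover have "x + v = (x + v') + v $ j *\<^sub>R axis j 1" by (simp add: v'_def)
      ultimately show ?thesis unfolding K'_def using v(1) by blast
    qed
    then show ?case
      using step bd K(3) insert.hyps by (intro exI[of _ K']) (auto simp: algebra_simps)
  qed
  from this[of UNIV] obtain K where "convex K" "\<forall>x\<in>K. \<forall>i. 0 \<le> x $ i \<and> x $ i \<le> 2"
      "measure lebesgue K \<le> measure lebesgue C + real CARD('n) * (2 * s * 3 ^ CARD('n))"
      "\<forall>x\<in>C. \<forall>v. (\<forall>i. 0 \<le> v $ i \<and> v $ i \<le> s) \<longrightarrow> x + v \<in> K" by auto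
  then show thesis by (intro that[of K]) auto
qed

lemma inner_parallel_body:
  fixes C :: "(real^'n::finite) set"
  assumes "convex C" "\<And>x i. x \<in> C \<Longrightarrow> 0 \<le> x $ i \<and> x $ i \<le> 1" "0 < s" "s \<le> 1"
  obtains K where "convex K" "K \<subseteq> C"
    "measure lebesgue C \<le> measure lebesgue K + real CARD('n) * (2 * s * 3 ^ CARD('n))"
    "\<And>x v. x \<in> K \<Longrightarrow> (\<And>i. 0 \<le> v $ i \<and> v $ i \<le> s) \<Longrightarrow> x + v \<in> C"
proof -
  have "\<exists>K. convex K \<and> K \<subseteq> C \<and>
      measure lebesgue C \<le> measure lebesgue K + real (card J) * (2 * s * 3 ^ CARD('n)) \<and>
      (\<forall>x\<in>K. \<forall>v. (\<forall>i. 0 \<le> v $ i \<and> v $ i \<le> s) \<longrightarrow> (\<forall>i. i \<notin> J \<longrightarrow> v $ i = 0) \<longrightarrow> x + v \<in> C)"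
    if "finite J" for J :: "'n set"
    using that
  proof (induction rule: finite_induct)
    case empty
    have "x + v \<in> C" if "x \<in> C" "\<forall>i. v $ i = 0" for x v
    proof -
      have "v = 0" using that(2) by (simp add: vec_eq_iff)
      then show ?thesis using that(1) by simp
    qed
    then show ?case using assms by (intro exI[of _ C]) auto
  next
    case (insert j J)
    then obtain K where K: "convex K" "K \<subseteq> C"
      "measure lebesgue C \<le> measure lebesgue K + real (card J) * (2 * s * 3 ^ CARD('n))"
      "\<forall>x\<in>K. \<forall>v. (\<forall>i. 0 \<le> v $ i \<and> v $ i \<le> s) \<longrightarrow> (\<forall>i. i \<notin> J \<longrightarrow> v $ i = 0) \<longrightarrow> x + v \<in> C"
      by blast
    define K' where "K' = {x \<in> K. x + s *\<^sub>R axis j 1 \<in> K}"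
    have bd: "0 \<le> x $ i \<and> x $ i \<le> 2" if "x \<in> K" for x i
      using assms(2)[of x i] K(2) that by auto
    have step: "convex K'" "measure lebesgue K \<le> measure lebesgue K' + 2 * s * 3 ^ CARD('n)"
      using measure_inner_step[OF K(1) bd assms(3,4) K'_def] by auto
    have "x + v \<in> C" if x: "x \<in> K'" and v: "\<forall>i. 0 \<le> v $ i \<and> v $ i \<le> s" "\<forall>i. i \<notin> insert j J \<longrightarrow> v $ i = 0" for x v
    proof -
      define v' where "v' = v - v $ j *\<^sub>R axis j 1"
      have v': "v' $ i = (if i = j then 0 else v $ i)" for i by (auto simp: v'_def axis_def)
      \<comment> \<open>Membership in \<open>K'\<close> tests only the far endpoint x + s e_j;
        convexity supplies the intermediate shifts.\<close>
      have "x + v $ j *\<^sub>R axis j 1 \<in> K"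
      proof (rule convex_line_between[OF K(1)])
        show "(x + v $ j *\<^sub>R axis j 1) - v $ j *\<^sub>R axis j 1 \<in> K" using x by (simp add: K'_def)
        show "(x + v $ j *\<^sub>R axis j 1) + (s - v $ j) *\<^sub>R axis j 1 \<in> K"
          using x by (simp add: K'_def algebra_simps)
      qed (use v in auto)
      then have "(x + v $ j *\<^sub>R axis j 1) + v' \<in> C"
        using K(4)[rule_format, of "x + v $ j *\<^sub>R axis j 1" v'] v assms(3) by (auto simp: v')
      then show ?thesis by (simp add: v'_def)
    qed
    then show ?case
      using step K(2,3) insert.hyps by (intro exI[of _ K']) (auto simp: algebra_simps K'_def)
  qed
  from this[of UNIV] obtain K where "convex K" "K \<subseteq> C"
      "measure lebesgue C \<le> measure lebesgue K + real CARD('n) * (2 * s * 3 ^ CARD('n))"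
      "\<forall>x\<in>K. \<forall>v. (\<forall>i. 0 \<le> v $ i \<and> v $ i \<le> s) \<longrightarrow> x + v \<in> C" by auto
  then show thesis by (intro that[of K]) auto
qed

section \<open>Lattice points in translates\<close>

text \<open>The group generated by Z^d and z / N. Letting \<open>n\<close> range over all integers
  makes closure under addition immediate; the reduction to 0 <= n < N is recovered in
  \<open>lattice_eq\<close>.\<close>

definition lattice :: "nat \<Rightarrow> ('n::finite \<Rightarrow> int) \<Rightarrow> (real^'n) set" where
  "lattice N z = {x. \<exists>n::int. \<forall>j. x $ j - of_int n * of_int (z j) / real N \<in> \<int>}"

definition int_vec :: "('n::finite \<Rightarrow> int) \<Rightarrow> real^'n" where
  "int_vec k = (\<chi> j. of_int (k j))"

lemma lattice_add:
  assumes "x \<in> lattice N z" "y \<in> lattice N z"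
  shows "x + y \<in> lattice N z"
proof -
  obtain m n :: int where m: "\<And>j. x $ j - of_int m * of_int (z j) / real N \<in> \<int>"
    and n: "\<And>j. y $ j - of_int n * of_int (z j) / real N \<in> \<int>"
    using assms unfolding lattice_def by auto
  have "(x + y) $ j - of_int (m + n) * of_int (z j) / real N \<in> \<int>" for j
    using Ints_add[OF m[of j] n[of j]] by (simp add: algebra_simps add_divide_distrib)
  then show ?thesis unfolding lattice_def by blast
qed

lemma lattice_pt_bounds: "0 \<le> lattice_pt N z n $ j" "lattice_pt N z n $ j < 1"
  by (simp_all add: lattice_pt_def frac_lt_1)

lemma lattice_pt_in_lattice: "lattice_pt N z n + int_vec k \<in> lattice N z"
proof -
  have "(lattice_pt N z n + int_vec k) $ j - of_int (int n) * of_int (z j) / real N \<in> \<int>" for j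
    by (simp add: lattice_pt_def int_vec_def frac_def)
  then show ?thesis unfolding lattice_def by blast
qed

lemma lattice_eq:
  assumes "N > 0"
  shows "lattice N z = {lattice_pt N z n + int_vec k |n k. n < N}"
proof (intro equalityI subsetI)
  fix x assume "x \<in> lattice N z"
  then obtain m :: int where m: "\<And>j. x $ j - of_int m * of_int (z j) / real N \<in> \<int>"
    unfolding lattice_def by auto
  define n where "n = nat (m mod int N)"
  have "n < N" using assms by (simp add: n_def nat_less_iff)
  have "m = int n + int N * (m div int N)"
    using assms by (simp add: n_def)
  then have rm: "real_of_int m = real n + real N * of_int (m div int N)"
    by (metis of_int_add of_int_mult of_int_of_nat_eq)
  have "x $ j - lattice_pt N z n $ j \<in> \<int>" for j
  proof -
    have "of_int m * of_int (z j) / real N = real n * of_int (z j) / real N + of_int (m div int N) * of_int (z j)"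
      using assms unfolding rm by (simp add: add_divide_distrib distrib_right)
    then have "x $ j - lattice_pt N z n $ j = (x $ j - of_int m * of_int (z j) / real N) +
       of_int (m div int N) * of_int (z j) + of_int \<lfloor>real n * of_int (z j) / real N\<rfloor>"
      by (simp add: lattice_pt_def frac_def)
    also have "\<dots> \<in> \<int>" using m by (intro Ints_add Ints_mult) auto
    finally show ?thesis .
  qed
  then have "of_int \<lfloor>x $ j - lattice_pt N z n $ j\<rfloor> = x $ j - lattice_pt N z n $ j" for j
    by (metis Ints_cases floor_of_int)
  then have "x = lattice_pt N z n + int_vec (\<lambda>j. \<lfloor>x $ j - lattice_pt N z n $ j\<rfloor>)"
    by (simp add: vec_eq_iff int_vec_def del: of_int_floor_cancel)
  then show "x \<in> {lattice_pt N z n + int_vec k |n k. n < N}" using \<open>n < N\<close> by blast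
qed (auto simp: lattice_pt_in_lattice)

lemma lattice_in_unit_cube:
  assumes "N > 0"
  shows "lattice N z \<inter> unit_cube = lattice_pt N z ` {..<N}"
proof (intro equalityI subsetI)
  fix x assume x: "x \<in> lattice N z \<inter> unit_cube"
  then obtain n k where nk: "x = lattice_pt N z n + int_vec k" "n < N"
    unfolding lattice_eq[OF assms] by blast
  have "k j = 0" for j
  proof -
    have "0 \<le> lattice_pt N z n $ j + of_int (k j)" "lattice_pt N z n $ j + of_int (k j) < 1"
      using x unfolding nk unit_cube_def by (simp_all add: int_vec_def)
    then show ?thesis using lattice_pt_bounds[of N z n j] by linarith
  qed
  then have "x = lattice_pt N z n" unfolding nk by (simp add: int_vec_def vec_eq_iff)
  then show "x \<in> lattice_pt N z ` {..<N}" using nk by blast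
next
  fix x assume "x \<in> lattice_pt N z ` {..<N}"
  then obtain n where n: "x = lattice_pt N z n" by blast
  have "int_vec (\<lambda>_. 0) = (0 :: real^'a)" by (simp add: int_vec_def vec_eq_iff)
  then have "x \<in> lattice N z" using lattice_pt_in_lattice[of N z n "\<lambda>_. 0"] n by simp
  then show "x \<in> lattice N z \<inter> unit_cube"
    using lattice_pt_bounds unfolding n unit_cube_def by auto
qed

lemma unit_cube_measure:
  "(unit_cube :: (real^'n::finite) set) \<in> lmeasurable" "measure lebesgue (unit_cube :: (real^'n) set) = 1"
proof -
  have "convex (unit_cube :: (real^'n) set)"
  proof (rule convexI)
    fix x y :: "real^'n" and u v :: real
    assume x: "x \<in> unit_cube" "y \<in> unit_cube" and uv: "0 \<le> u" "0 \<le> v" "u + v = 1"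
    have "0 \<le> u * x $ j + v * y $ j \<and> u * x $ j + v * y $ j < 1" for j
      using x uv convex_bound_lt[of "x $ j" 1 "y $ j" u v] unfolding unit_cube_def by simp
    then show "u *\<^sub>R x + v *\<^sub>R y \<in> unit_cube" by (simp add: unit_cube_def)
  qed
  moreover have sub: "unit_cube \<subseteq> cbox 0 (\<chi> i. 1) \<and> box 0 (\<chi> i. 1) \<subseteq> (unit_cube :: (real^'n) set)"
    by (auto simp: unit_cube_def mem_box_cart less_imp_le)
  moreover have "bounded (unit_cube :: (real^'n) set)"
    using sub bounded_subset[OF bounded_cbox] by blast
  ultimately show meas: "(unit_cube :: (real^'n) set) \<in> lmeasurable"
    by (intro measurable_convex)
  have "cbox 0 (\<chi> i. 1) \<noteq> ({} :: (real^'n) set)"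
    by (auto simp: interval_ne_empty_cart)
  then have c: "measure lebesgue (cbox 0 (\<chi> i. 1) :: (real^'n) set) = 1"
    by (simp add: content_cbox_cart)
  have "measure lebesgue (unit_cube :: (real^'n) set) \<le> measure lebesgue (cbox 0 (\<chi> i. 1) :: (real^'n) set)"
    using sub meas by (intro measure_mono_fmeasurable) auto
  moreover have "measure lebesgue (box 0 (\<chi> i. 1) :: (real^'n) set) \<le> measure lebesgue (unit_cube :: (real^'n) set)"
    using sub meas by (intro measure_mono_fmeasurable) auto
  moreover have "measure lebesgue (box 0 (\<chi> i. 1) :: (real^'n) set) = measure lebesgue (cbox 0 (\<chi> i. 1) :: (real^'n) set)"
    by (simp add: measure_lborel_box_eq measure_lborel_cbox_eq)
  ultimately show "measure lebesgue (unit_cube :: (real^'n) set) = 1" using c by linarith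
qed

text \<open>Integer translates of the half-open unit cube tile space, so averaging the number of lattice
  points in \<open>A - y\<close> over \<open>y\<close> in the unit cube gives exactly \<open>N\<close> times the volume of \<open>A\<close>.\<close>

lemma lattice_count_average:
  fixes z :: "'n::finite \<Rightarrow> int" and A :: "(real^'n) set"
  assumes "N > 0" and inj: "inj_on (lattice_pt N z) {..<N}"
    and A: "A \<in> lmeasurable" "\<And>x j. x \<in> A \<Longrightarrow> 0 \<le> x $ j \<and> x $ j \<le> 2"
  defines "cnt \<equiv> \<lambda>y. real (card {x \<in> lattice N z. x + y \<in> A})"
  shows "\<exists>y\<in>unit_cube. finite {x \<in> lattice N z. x + y \<in> A} \<and> cnt y \<le> real N * measure lebesgue A"
    and "\<exists>y\<in>unit_cube. finite {x \<in> lattice N z. x + y \<in> A} \<and> real N * measure lebesgue A \<le> cnt y"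
proof -
  \<comment> \<open>A finite index set suffices: points of \<open>A\<close> have coordinates in
    [0, 2], while \<open>lattice_pt\<close> and the shift \<open>y\<close> have theirs in [0, 1), so
    the integer part \<open>k\<close> of a relevant lattice point lies between -2 and 2.\<close>
  define I where "I = {..<N} \<times> (PiE UNIV (\<lambda>_. {-2..2}) :: ('n \<Rightarrow> int) set)"
  define p where "p = (\<lambda>(n, k). lattice_pt N z n + int_vec k)"
  have "finite I" unfolding I_def by (intro finite_cartesian_product finite_PiE) auto
  have mem_I: "n < N \<Longrightarrow> (\<And>j. -2 \<le> k j \<and> k j \<le> 2) \<Longrightarrow> (n, k) \<in> I" for n k
    unfolding I_def by (auto simp: PiE_def)
  have "inj_on p I"
  proof (rule inj_onI)
    fix i i' assume i: "i \<in> I" "i' \<in> I" "p i = p i'"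
    obtain n k m l where nk: "i = (n, k)" "i' = (m, l)" by fastforce
    have eq: "lattice_pt N z n $ j + of_int (k j) = lattice_pt N z m $ j + of_int (l j)" for j
      using i(3) unfolding nk p_def by (simp add: vec_eq_iff int_vec_def)
    have kl: "k j = l j" for j
      using eq[of j] lattice_pt_bounds[of N z n j] lattice_pt_bounds[of N z m j] by linarith
    then have "lattice_pt N z n = lattice_pt N z m" using eq by (simp add: vec_eq_iff)
    then show "i = i'" using inj i kl unfolding nk I_def by (auto dest: inj_onD)
  qed
  \<comment> \<open>\<open>V i\<close> is the set of shifts that carry the i-th lattice point into
    \<open>A\<close>, \<open>W i\<close> the part of \<open>A\<close> in the unit cube placed at
    that point. They are translates of each other, and for fixed \<open>n\<close> the
    \<open>W (n, k)\<close> partition \<open>A\<close>, so every residue \<open>n\<close>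
    contributes the volume of \<open>A\<close> once.\<close>
  define V where "V i = {y \<in> unit_cube. p i + y \<in> A}" for i
  define W where "W i = A \<inter> (+) (p i) ` unit_cube" for i
  have W: "W i \<in> lmeasurable" for i
    unfolding W_def using A(1) unit_cube_measure(1) by (intro fmeasurable.Int measurable_translation)
  have VW: "V i = (+) (- p i) ` W i" for i
  proof (intro equalityI subsetI)
    fix y assume "y \<in> V i"
    then have "p i + y \<in> W i" by (auto simp: V_def W_def)
    then show "y \<in> (+) (- p i) ` W i" by (rule rev_image_eqI) simp
  next
    fix y assume "y \<in> (+) (- p i) ` W i"
    then obtain w where "w \<in> W i" "y = - p i + w" by blast
    then show "y \<in> V i" by (auto simp: V_def W_def)
  qed
  have V: "V i \<in> lmeasurable" "measure lebesgue (V i) = measure lebesgue (W i)" for i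
    unfolding VW by (rule measurable_translation[OF W], rule measure_translation)
  have set_eq: "{x \<in> lattice N z. x + y \<in> A} = p ` {i \<in> I. y \<in> V i}" if y: "y \<in> unit_cube" for y
  proof (intro equalityI subsetI)
    fix x assume x: "x \<in> {x \<in> lattice N z. x + y \<in> A}"
    then obtain n k where nk: "x = lattice_pt N z n + int_vec k" "n < N"
      unfolding lattice_eq[OF assms(1)] by blast
    have "-2 \<le> k j \<and> k j \<le> 2" for j
    proof -
      have "0 \<le> lattice_pt N z n $ j + of_int (k j) + y $ j \<and> lattice_pt N z n $ j + of_int (k j) + y $ j \<le> 2"
        using A(2)[of "x + y" j] x unfolding nk by (simp add: int_vec_def)
      moreover have "0 \<le> y $ j" "y $ j < 1" using y by (auto simp: unit_cube_def)
      ultimately show ?thesis using lattice_pt_bounds[of N z n j] by linarith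
    qed
    then have "(n, k) \<in> I" using nk(2) by (intro mem_I) auto
    then show "x \<in> p ` {i \<in> I. y \<in> V i}"
      using x y nk by (intro image_eqI[of _ _ "(n, k)"]) (auto simp: p_def V_def)
  next
    fix x assume "x \<in> p ` {i \<in> I. y \<in> V i}"
    then show "x \<in> {x \<in> lattice N z. x + y \<in> A}"
      by (auto simp: p_def V_def lattice_pt_in_lattice)
  qed
  have cnt_eq: "cnt y = (\<Sum>i\<in>I. indicator (V i) y)" if y: "y \<in> unit_cube" for y
  proof -
    have "card (p ` {i \<in> I. y \<in> V i}) = card {i \<in> I. y \<in> V i}"
      using \<open>inj_on p I\<close> by (intro card_image) (auto intro: inj_on_subset)
    then show ?thesis
      unfolding cnt_def set_eq[OF y] using \<open>finite I\<close>
      by (simp add: indicator_def sum.If_cases Int_def)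
  qed
  have fin: "finite {x \<in> lattice N z. x + y \<in> A}" if "y \<in> unit_cube" for y
    unfolding set_eq[OF that] using \<open>finite I\<close> by auto
  have sum_n: "(\<Sum>k\<in>PiE UNIV (\<lambda>_. {-2..2}). measure lebesgue (W (n, k))) = measure lebesgue A" if "n < N" for n
  proof -
    have "(\<Sum>k\<in>PiE UNIV (\<lambda>_. {-2..2}). measure lebesgue (W (n, k))) =
        measure lebesgue (\<Union>k\<in>PiE UNIV (\<lambda>_. {-2..2}). W (n, k))"
    proof (rule measure_UNION'[symmetric])
      show "finite (PiE UNIV (\<lambda>_. {-2..2}) :: ('n \<Rightarrow> int) set)" by (intro finite_PiE) auto
      show "pairwise (\<lambda>k l. disjnt (W (n, k)) (W (n, l))) (PiE UNIV (\<lambda>_. {-2..2}))"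
      proof (rule pairwiseI)
        fix k l :: "'n \<Rightarrow> int" assume "k \<noteq> l"
        then obtain j where j: "k j \<noteq> l j" by blast
        show "disjnt (W (n, k)) (W (n, l))"
        proof (rule ccontr)
          assume "\<not> ?thesis"
          then obtain u v where uv: "u \<in> unit_cube" "v \<in> unit_cube" "p (n, k) + u = p (n, l) + v"
            unfolding W_def disjnt_def by blast
          have "of_int (k j) + u $ j = of_int (l j) + v $ j"
            using arg_cong[OF uv(3), of "\<lambda>x. x $ j"] by (simp add: p_def int_vec_def)
          moreover have "0 \<le> u $ j" "u $ j < 1" "0 \<le> v $ j" "v $ j < 1"
            using uv(1,2) by (auto simp: unit_cube_def)
          ultimately have "k j = l j" by linarith
          with j show False by simp
        qed
      qed
    qed (rule W)
    also have "(\<Union>k\<in>PiE UNIV (\<lambda>_. {-2..2}). W (n, k)) = A"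
    proof (intro equalityI subsetI)
      fix x assume x: "x \<in> A"
      define k where "k j = \<lfloor>x $ j - lattice_pt N z n $ j\<rfloor>" for j
      have "-2 \<le> k j \<and> k j \<le> 2" for j
        using A(2)[OF x, of j] lattice_pt_bounds[of N z n j] unfolding k_def by linarith
      then have "k \<in> PiE UNIV (\<lambda>_. {-2..2})" by auto
      moreover have "x - p (n, k) \<in> unit_cube"
      proof -
        have "0 \<le> x $ j - (lattice_pt N z n $ j + of_int (k j)) \<and> x $ j - (lattice_pt N z n $ j + of_int (k j)) < 1" for j
          unfolding k_def by linarith
        then show ?thesis unfolding unit_cube_def p_def int_vec_def by simp
      qed
      then have "x \<in> W (n, k)" using x unfolding W_def by (auto intro!: image_eqI[of _ _ "x - p (n, k)"])
      ultimately show "x \<in> (\<Union>k\<in>PiE UNIV (\<lambda>_. {-2..2}). W (n, k))" by blast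
    qed (auto simp: W_def)
    finally show ?thesis .
  qed
  have int_V: "integrable lebesgue (indicator (V i) :: _ \<Rightarrow> real)" for i
    using V(1)[of i] by (intro integrable_real_indicator) (auto simp: fmeasurable_def less_top)
  define f where "f y = (\<Sum>i\<in>I. indicator (V i) y :: real)" for y
  have int_f: "integrable lebesgue f"
    unfolding f_def using int_V by (intro Bochner_Integration.integrable_sum)
  have "integral\<^sup>L lebesgue f = (\<Sum>i\<in>I. measure lebesgue (V i))"
    unfolding f_def using int_V by (subst Bochner_Integration.integral_sum) simp_all
  also have "\<dots> = (\<Sum>n<N. \<Sum>k\<in>PiE UNIV (\<lambda>_. {-2..2}). measure lebesgue (W (n, k)))"
    unfolding I_def V(2) by (simp add: sum.cartesian_product)
  also have "\<dots> = real N * measure lebesgue A" by (simp add: sum_n)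
  finally have int_val: "integral\<^sup>L lebesgue f = real N * measure lebesgue A" .
  have f_out: "f y = 0" if "y \<notin> unit_cube" for y
    unfolding f_def using that by (auto simp: V_def)
  have f_cnt: "f y = cnt y" if "y \<in> unit_cube" for y
    using cnt_eq[OF that] by (simp add: f_def)
  define g where "g c y = c * indicator (unit_cube :: (real^'n) set) y" for c :: real and y
  have g: "integrable lebesgue (g c)" "integral\<^sup>L lebesgue (g c) = c" for c
    unfolding g_def using unit_cube_measure[where 'n = 'n] by (auto simp: fmeasurable_def)
  have f_nat: "\<exists>c::nat. f y = real c" for y
    unfolding f_def indicator_def by (auto simp: sum.If_cases \<open>finite I\<close>)
  show "\<exists>y\<in>unit_cube. finite {x \<in> lattice N z. x + y \<in> A} \<and> cnt y \<le> real N * measure lebesgue A"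
  proof (rule ccontr)
    assume neg: "\<not> ?thesis"
    have gt: "f y > real N * measure lebesgue A" if "y \<in> unit_cube" for y
      using neg fin[OF that] f_cnt[OF that] that by fastforce
    \<comment> \<open>Counts are integers, so the strict pointwise inequality improves to a constant
      bound \<open>c\<close> strictly above the mean. Integrating a weak inequality then suffices.
      The second half uses the mirror image.\<close>
    define c where "c = real_of_int (\<lfloor>real N * measure lebesgue A\<rfloor> + 1)"
    have "c \<le> f y" if y: "y \<in> unit_cube" for y
    proof -
      obtain k :: nat where k: "f y = real k" using f_nat by blast
      have "\<lfloor>real N * measure lebesgue A\<rfloor> < int k" using gt[OF y] unfolding k by (simp add: floor_less_iff)
      then show ?thesis unfolding c_def k by linarith
    qed
    then have "integral\<^sup>L lebesgue (g c) \<le> integral\<^sup>L lebesgue f"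
      using g int_f f_out by (intro integral_mono) (auto simp: g_def indicator_def)
    moreover have "c > real N * measure lebesgue A" unfolding c_def by linarith
    ultimately show False using g(2) int_val by simp
  qed
  show "\<exists>y\<in>unit_cube. finite {x \<in> lattice N z. x + y \<in> A} \<and> real N * measure lebesgue A \<le> cnt y"
  proof (rule ccontr)
    assume neg: "\<not> ?thesis"
    have lt: "f y < real N * measure lebesgue A" if "y \<in> unit_cube" for y
      using neg fin[OF that] f_cnt[OF that] that by fastforce
    define c where "c = real_of_int (\<lceil>real N * measure lebesgue A\<rceil> - 1)"
    have "f y \<le> c" if y: "y \<in> unit_cube" for y
    proof -
      obtain k :: nat where k: "f y = real k" using f_nat by blast
      have "int k < \<lceil>real N * measure lebesgue A\<rceil>" using lt[OF y] unfolding k by (simp add: less_ceiling_iff)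
      then show ?thesis unfolding c_def k by linarith
    qed
    then have "integral\<^sup>L lebesgue f \<le> integral\<^sup>L lebesgue (g c)"
      using g int_f f_out by (intro integral_mono) (auto simp: g_def indicator_def)
    moreover have "c < real N * measure lebesgue A" unfolding c_def by linarith
    ultimately show False using g(2) int_val by simp
  qed
qed

section \<open>Discrepancy\<close>

text \<open>Upper bound: pick a shift y whose count in the thickened \<open>K\<close> is at most
  average, and a lattice vector u with u + y in [0, 2r]^d. Then x -> x + u sends lattice points of
  \<open>C\<close> injectively to lattice points counted by y. Lower bound: pick y whose count in
  the shrunken \<open>K\<close> is at least average and u with u - y in [0, 2r]^d; now x -> x + u
  sends the counted points into \<open>C\<close>.\<close>

lemma discrepancy_le_of_covering:
  fixes z :: "'n::finite \<Rightarrow> int" and C :: "(real^'n) set"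
  assumes "N > 0" and inj: "inj_on (lattice_pt N z) {..<N}"
    and cov: "\<And>y. \<exists>n<N. \<forall>j. dist_int (y j + real n * of_int (z j) / real N) < r"
    and r: "0 < r" "2 * r \<le> 1"
    and C: "convex C" "C \<subseteq> unit_cube"
  shows "\<bar>real (card {n. n < N \<and> lattice_pt N z n \<in> C}) / real N - measure lebesgue C\<bar>
    \<le> real CARD('n) * (2 * (2 * r) * 3 ^ CARD('n))" (is "_ \<le> ?b")
proof -
  \<comment> \<open>Covering the target \<open>y - r\<close> turns the symmetric window (-r, r) into
    [0, 2r], the one-sided displacements that the parallel bodies allow.\<close>
  have near: "\<exists>x\<in>lattice N z. \<forall>j. 0 \<le> x $ j + y $ j \<and> x $ j + y $ j \<le> 2 * r" for y :: "real^'n"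
  proof -
    obtain n where n: "\<And>j. dist_int (y $ j - r + real n * of_int (z j) / real N) < r"
      using cov[of "\<lambda>j. y $ j - r"] by blast
    define t where "t j = y $ j - r + real n * of_int (z j) / real N" for j
    define x :: "real^'n" where "x = (\<chi> j. real n * of_int (z j) / real N - of_int (round (t j)))"
    have "x $ j - of_int (int n) * of_int (z j) / real N \<in> \<int>" for j by (simp add: x_def)
    then have "x \<in> lattice N z" unfolding lattice_def by blast
    moreover have "0 \<le> x $ j + y $ j \<and> x $ j + y $ j \<le> 2 * r" for j
    proof -
      have "\<bar>t j - of_int (round (t j))\<bar> < r" using n[of j] by (simp add: t_def dist_int_eq_round)
      moreover have "x $ j + y $ j = t j - of_int (round (t j)) + r" by (simp add: x_def t_def)
      ultimately show ?thesis by linarith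
    qed
    ultimately show ?thesis by blast
  qed
  have Cb: "0 \<le> x $ i \<and> x $ i \<le> 1" if "x \<in> C" for x i
    using C(2) that unfolding unit_cube_def by (auto intro: less_imp_le)
  define M where "M = card {n. n < N \<and> lattice_pt N z n \<in> C}"
  have LC: "lattice N z \<inter> C = lattice_pt N z ` {n. n < N \<and> lattice_pt N z n \<in> C}"
    using lattice_in_unit_cube[OF \<open>N > 0\<close>, of z] C(2) by auto
  have M: "M = card (lattice N z \<inter> C)"
    unfolding M_def LC using inj by (intro card_image[symmetric]) (auto intro: inj_on_subset)
  have finLC: "finite (lattice N z \<inter> C)" unfolding LC by auto
  have r2: "0 < 2 * r" using r by simp
  have "real M \<le> real N * (measure lebesgue C + ?b)"
  proof -
    obtain K where K: "convex K" "\<And>x i. x \<in> K \<Longrightarrow> 0 \<le> x $ i \<and> x $ i \<le> 2"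
      "measure lebesgue K \<le> measure lebesgue C + ?b"
      "\<And>x v. x \<in> C \<Longrightarrow> (\<And>i. 0 \<le> v $ i \<and> v $ i \<le> 2 * r) \<Longrightarrow> x + v \<in> K"
      using outer_parallel_body[OF C(1) Cb r2 r(2)] by blast
    have "K \<in> lmeasurable" using K(1,2) by (intro measurable_convex bounded_of_coordinate_bounds)
    then obtain y where y: "finite {x \<in> lattice N z. x + y \<in> K}"
      "real (card {x \<in> lattice N z. x + y \<in> K}) \<le> real N * measure lebesgue K"
      using lattice_count_average(1)[OF \<open>N > 0\<close> inj, of K] K(2) by blast
    obtain u where u: "u \<in> lattice N z" "\<And>j. 0 \<le> u $ j + y $ j \<and> u $ j + y $ j \<le> 2 * r"
      using near[of y] by blast
    have "M \<le> card {x \<in> lattice N z. x + y \<in> K}"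
      unfolding M
    proof (rule card_inj_on_le[OF _ _ y(1)])
      show "inj_on (\<lambda>x. x + u) (lattice N z \<inter> C)" by (simp add: inj_on_def)
      show "(\<lambda>x. x + u) ` (lattice N z \<inter> C) \<subseteq> {x \<in> lattice N z. x + y \<in> K}"
      proof clarify
        fix x assume x: "x \<in> lattice N z" "x \<in> C"
        have "x + (u + y) \<in> K" using x(2) u(2) by (intro K(4)) auto
        then show "x + u \<in> lattice N z \<and> x + u + y \<in> K"
          using lattice_add[OF x(1) u(1)] by (simp add: add.assoc)
      qed
    qed
    then have "real M \<le> real N * measure lebesgue K" using y(2) by linarith
    also have "\<dots> \<le> real N * (measure lebesgue C + ?b)" using K(3) by (intro mult_left_mono) auto
    finally show ?thesis .
  qed
  then have upper: "real M / real N \<le> measure lebesgue C + ?b"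
    using \<open>N > 0\<close> by (simp add: divide_le_eq mult.commute)
  have "real N * (measure lebesgue C - ?b) \<le> real M"
  proof -
    obtain K where K: "convex K" "K \<subseteq> C" "measure lebesgue C \<le> measure lebesgue K + ?b"
      "\<And>x v. x \<in> K \<Longrightarrow> (\<And>i. 0 \<le> v $ i \<and> v $ i \<le> 2 * r) \<Longrightarrow> x + v \<in> C"
      using inner_parallel_body[OF C(1) Cb r2 r(2)] by blast
    have Kb: "0 \<le> x $ i \<and> x $ i \<le> 2" if "x \<in> K" for x i
      using Cb[of x i] K(2) that by auto
    have "K \<in> lmeasurable" using K(1) Kb by (intro measurable_convex bounded_of_coordinate_bounds)
    then obtain y where y: "real N * measure lebesgue K \<le> real (card {x \<in> lattice N z. x + y \<in> K})"
      using lattice_count_average(2)[OF \<open>N > 0\<close> inj, of K] Kb by blast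
    obtain u where u: "u \<in> lattice N z" "\<And>j. 0 \<le> u $ j - y $ j \<and> u $ j - y $ j \<le> 2 * r"
      using near[of "- y"] by auto
    have "card {x \<in> lattice N z. x + y \<in> K} \<le> M"
      unfolding M
    proof (rule card_inj_on_le[OF _ _ finLC])
      show "inj_on (\<lambda>x. x + u) {x \<in> lattice N z. x + y \<in> K}" by (simp add: inj_on_def)
      show "(\<lambda>x. x + u) ` {x \<in> lattice N z. x + y \<in> K} \<subseteq> lattice N z \<inter> C"
      proof clarify
        fix x assume x: "x \<in> lattice N z" "x + y \<in> K"
        have "(x + y) + (u - y) \<in> C" using x(2) u(2) by (intro K(4)) auto
        then show "x + u \<in> lattice N z \<inter> C"
          using lattice_add[OF x(1) u(1)] by simp
      qed
    qed
    then have "real N * measure lebesgue K \<le> real M" using y by linarith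
    moreover have "real N * (measure lebesgue C - ?b) \<le> real N * measure lebesgue K"
      using K(3) by (intro mult_left_mono) auto
    ultimately show ?thesis by linarith
  qed
  then have lower: "measure lebesgue C - ?b \<le> real M / real N"
    using \<open>N > 0\<close> by (simp add: le_divide_eq mult.commute)
  show ?thesis using upper lower unfolding M_def by linarith
qed

lemma iso_disc_le:
  assumes "\<And>C. convex C \<Longrightarrow> C \<subseteq> unit_cube \<Longrightarrow>
    \<bar>real (card {n. n < N \<and> p n \<in> C}) / real N - measure lebesgue C\<bar> \<le> b"
  shows "iso_disc N p \<le> b"
  unfolding iso_disc_def
proof (rule cSUP_least)
  show "{C. convex C \<and> C \<subseteq> unit_cube} \<noteq> {}" using convex_empty by blast
qed (use assms in auto)

text \<open>The trivial bound, for those N where no useful covering radius is available.\<close>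

lemma iso_disc_le_1:
  fixes p :: "nat \<Rightarrow> real^'n::finite"
  shows "iso_disc N p \<le> 1"
proof (rule iso_disc_le)
  fix C :: "(real^'n) set" assume C: "convex C" "C \<subseteq> unit_cube"
  have "card {n. n < N \<and> p n \<in> C} \<le> card {..<N}" by (intro card_mono) auto
  then have "real (card {n. n < N \<and> p n \<in> C}) / real N \<le> 1"
    by (cases "N = 0") (auto simp: divide_le_eq_1)
  moreover have "0 \<le> x $ i \<and> x $ i \<le> 2" if "x \<in> C" for x i
  proof -
    have "0 \<le> x $ i" "x $ i < 1" using C(2) that by (auto simp: unit_cube_def)
    then show ?thesis by simp
  qed
  then have "bounded C" by (rule bounded_of_coordinate_bounds)
  then have "measure lebesgue C \<le> 1"
    using measure_mono_fmeasurable[OF C(2) _ unit_cube_measure(1)] measurable_convex[OF C(1)]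
    by (auto simp: unit_cube_measure(2) fmeasurable_def)
  moreover have "0 \<le> measure lebesgue C" "0 \<le> real (card {n. n < N \<and> p n \<in> C}) / real N" by auto
  ultimately show "\<bar>real (card {n. n < N \<and> p n \<in> C}) / real N - measure lebesgue C\<bar> \<le> 1" by linarith
qed

text \<open>A collision at index difference t makes t z / N an integer vector, so t a is within t /
  N times the error of N a of that vector. Since t < N, the smaller denominator t would beat the
  record N.\<close>

lemma inj_on_lattice_pt_best_den:
  fixes a :: "real^'n::finite"
  assumes irr: "\<And>j. a $ j \<notin> \<rat>"
  shows "inj_on (lattice_pt (best_den a i) (best_z a i)) {..<best_den a i}"
proof -
  define N where "N = best_den a i"
  define z where "z = best_z a i"
  have "N > 0" using best_den_record[OF irr, of i] by (simp add: N_def)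
  have False if nm: "n < m" "m < N" "lattice_pt N z n = lattice_pt N z m" for n m
  proof -
    define t where "t = m - n"
    have t: "0 < t" "t < N" using nm by (auto simp: t_def)
    have tpos: "0 < tnorm (real N *\<^sub>R a)" by (rule tnorm_multiple_pos[OF irr \<open>N > 0\<close>])
    have "dist_int (real t * a $ j) < tnorm (real N *\<^sub>R a)" for j
    proof -
      have "frac (real n * of_int (z j) / real N) = frac (real m * of_int (z j) / real N)"
        using arg_cong[OF nm(3), of "\<lambda>x. x $ j"] by (simp add: lattice_pt_def)
      then have "real m * of_int (z j) / real N - real n * of_int (z j) / real N =
          of_int (\<lfloor>real m * of_int (z j) / real N\<rfloor> - \<lfloor>real n * of_int (z j) / real N\<rfloor>)"
        unfolding frac_def of_int_diff by linarith
      then obtain w :: int where w: "real m * of_int (z j) / real N - real n * of_int (z j) / real N = of_int w"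
        by blast
      have "real t = real m - real n" using nm by (simp add: t_def)
      then have tw: "real t * of_int (z j) / real N = of_int w"
        using w by (simp add: left_diff_distrib diff_divide_distrib)
      have "real t * a $ j - of_int w = (real t / real N) * (real N * a $ j - of_int (z j))"
        unfolding tw[symmetric] using \<open>N > 0\<close> by (simp add: field_simps)
      then have "dist_int (real t * a $ j) \<le> (real t / real N) * \<bar>real N * a $ j - of_int (z j)\<bar>"
        using dist_int_le[of "real t * a $ j" w] by (simp add: abs_mult)
      also have "\<bar>real N * a $ j - of_int (z j)\<bar> = dist_int ((real N *\<^sub>R a) $ j)"
        by (simp add: dist_int_eq_round z_def best_z_def N_def)
      finally have "dist_int (real t * a $ j) \<le> (real t / real N) * dist_int ((real N *\<^sub>R a) $ j)" .
      also have "\<dots> \<le> (real t / real N) * tnorm (real N *\<^sub>R a)"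
        by (intro mult_left_mono dist_int_le_tnorm) auto
      also have "\<dots> < 1 * tnorm (real N *\<^sub>R a)"
        using t tpos by (intro mult_strict_right_mono) auto
      finally show ?thesis by simp
    qed
    then have "tnorm (real t *\<^sub>R a) < tnorm (real N *\<^sub>R a)" by (simp add: tnorm_less_iff)
    moreover have "tnorm (real N *\<^sub>R a) < tnorm (real t *\<^sub>R a)"
      using best_den_record[OF irr, of i] t unfolding N_def by blast
    ultimately show False by simp
  qed
  then show ?thesis
    unfolding N_def[symmetric] z_def[symmetric] by (intro linorder_inj_onI') force
qed

theorem mainTheorem7:
  fixes a :: "real^'n::finite"
  assumes lin_indep: "\<And>q0 q. q0 \<in> \<rat> \<Longrightarrow> (\<forall>j. q j \<in> \<rat>) \<Longrightarrow>
             q0 + (\<Sum>j\<in>UNIV. q j * a $ j) = 0 \<Longrightarrow> q0 = 0 \<and> (\<forall>j. q j = 0)"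
    and field: "\<forall>x\<in>rat_span a. \<forall>y\<in>rat_span a. x * y \<in> rat_span a \<and> (x \<noteq> 0 \<longrightarrow> inverse x \<in> rat_span a)"
  shows "\<exists>C::real. \<forall>i\<ge>2.
           iso_disc (best_den a i) (lattice_pt (best_den a i) (best_z a i))
             \<le> C / real (best_den a i) powr (1 / real CARD('n))"
proof -
  define d where "d = CARD('n)"
  have d: "d \<ge> 1" unfolding d_def by (simp add: Suc_le_eq)
  have irr: "a $ j \<notin> \<rat>" for j using coord_irrational[OF lin_indep] by blast
  obtain c where "c > 0" and dual: "\<And>i (h::'n \<Rightarrow> int) B. i \<ge> 2 \<Longrightarrow> (\<exists>j. h j \<noteq> 0) \<Longrightarrow>
     (\<forall>j. \<bar>real_of_int (h j)\<bar> \<le> B) \<Longrightarrow> int (best_den a i) dvd (\<Sum>j\<in>UNIV. h j * best_z a i j) \<Longrightarrow>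
     c * real (best_den a i) powr (1 / real d) \<le> B"
    using dual_vector_lower_bound[OF lin_indep field] unfolding d_def by blast
  \<comment> \<open>\<open>E * (2 * r)\<close> is the discrepancy bound at covering radius
    \<open>r\<close>.\<close>
  define E where "E = real d * (2 * 3 ^ d)"
  have "(1::real) \<le> 2 * 3 ^ d" using one_le_power[of "3::real" d] by linarith
  then have "1 * 1 \<le> real d * (2 * 3 ^ d)" using d by (intro mult_mono) auto
  then have "E \<ge> 1" by (simp add: E_def)
  have "iso_disc (best_den a i) (lattice_pt (best_den a i) (best_z a i))
      \<le> (4 / c + 16 * real d * E / c) / real (best_den a i) powr (1 / real d)" if i: "i \<ge> 2" for i
  proof -
    define N where "N = best_den a i"
    define z where "z = best_z a i"
    define x where "x = real N powr (1 / real d)"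
    have "N > 0" using best_den_ge_2[OF irr i] by (simp add: N_def)
    then have "x > 0" by (simp add: x_def)
    \<comment> \<open>The largest \<open>q\<close> with \<open>4 * q < c * x\<close>, so that no
      nonzero dual vector lies in the box required by \<open>lattice_covering\<close>. If
      \<open>q = 0\<close> then \<open>c * x <= 4\<close>, and the summand \<open>4 / c\<close>
      already makes the claim weaker than the trivial bound; otherwise
      \<open>c * x <= 8 * q\<close>, which leads to the other summand.\<close>
    define q where "q = nat (\<lceil>c * x / 4\<rceil> - 1)"
    have "c * x > 0" using \<open>c > 0\<close> \<open>x > 0\<close> by simp
    then have q: "4 * real q < c * x" "c * x \<le> 4 * real q + 4"
      unfolding q_def by linarith+
    have "iso_disc N (lattice_pt N z) \<le> (4 / c + 16 * real d * E / c) / x"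
    proof (cases "q = 0")
      case True
      then have "1 \<le> 4 / c / x" using q(2) \<open>c > 0\<close> \<open>x > 0\<close> by (simp add: field_simps)
      moreover have "0 \<le> 16 * real d * E / c / x" using \<open>c > 0\<close> \<open>x > 0\<close> \<open>E \<ge> 1\<close> by simp
      ultimately show ?thesis
        using iso_disc_le_1[of N "lattice_pt N z"] by (simp add: add_divide_distrib)
    next
      case False
      define r where "r = real d / real q"
      have "r > 0" using False d by (simp add: r_def)
      have cov: "\<exists>n<N. \<forall>j. dist_int (y j + real n * of_int (z j) / real N) < r" for y :: "'n \<Rightarrow> real"
        unfolding r_def d_def
      proof (rule lattice_covering[OF \<open>N > 0\<close>])
        fix h :: "'n \<Rightarrow> int" assume h: "\<exists>j. h j \<noteq> 0" "\<forall>j. \<bar>h j\<bar> \<le> 4 * int q"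
        show "\<not> int N dvd (\<Sum>j\<in>UNIV. h j * z j)"
        proof
          assume dvd: "int N dvd (\<Sum>j\<in>UNIV. h j * z j)"
          have "\<bar>real_of_int (h j)\<bar> \<le> 4 * real q" for j
            using h(2)[rule_format, of j] by linarith
          then have "c * x \<le> 4 * real q"
            using dual[OF i h(1), of "4 * real q"] dvd unfolding N_def z_def x_def by blast
          with q(1) show False by simp
        qed
      qed (use False in simp)
      have "iso_disc N (lattice_pt N z) \<le> E * (2 * r)"
      proof (cases "2 * r \<le> 1")
        case True
        have inj: "inj_on (lattice_pt N z) {..<N}"
          unfolding N_def z_def by (rule inj_on_lattice_pt_best_den[OF irr])
        show ?thesis
        proof (rule iso_disc_le)
          fix C :: "(real^'n) set" assume C: "convex C" "C \<subseteq> unit_cube"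
          show "\<bar>real (card {n. n < N \<and> lattice_pt N z n \<in> C}) / real N - measure lebesgue C\<bar> \<le> E * (2 * r)"
            using discrepancy_le_of_covering[OF \<open>N > 0\<close> inj cov \<open>r > 0\<close> True C]
            by (simp add: E_def d_def mult_ac)
        qed
      next
        \<comment> \<open>The parallel bodies require \<open>2 * r <= 1\<close>. Beyond that,
          \<open>E >= 1\<close> makes the claimed bound exceed the trivial one.\<close>
        case False
        then have "1 * 1 \<le> E * (2 * r)" using \<open>E \<ge> 1\<close> by (intro mult_mono) auto
        then show ?thesis using iso_disc_le_1[of N "lattice_pt N z"] by linarith
      qed
      also have "\<dots> \<le> E * (16 * real d / (c * x))"
      proof (rule mult_left_mono)
        have "c * x \<le> 8 * real q" using q(2) False by linarith
        then have "2 * r * (c * x) \<le> 2 * r * (8 * real q)" using \<open>r > 0\<close> by (intro mult_left_mono) auto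
        also have "\<dots> = 16 * real d" using False by (simp add: r_def)
        finally show "2 * r \<le> 16 * real d / (c * x)" using \<open>c * x > 0\<close> by (simp add: le_divide_eq)
      qed (use \<open>E \<ge> 1\<close> in simp)
      also have "\<dots> = 16 * real d * E / c / x" by simp
      also have "\<dots> \<le> (4 / c + 16 * real d * E / c) / x"
        using \<open>c > 0\<close> \<open>x > 0\<close> by (intro divide_right_mono) auto
      finally show ?thesis .
    qed
    then show ?thesis by (simp add: N_def z_def x_def)
  qed
  then show ?thesis unfolding d_def by blast
qed

end
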